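(* For every connected graph $F$ of order $3$ or more, there exist infinitely many (pairwise non-isomorphic) $F$-irregular graphs.
   Context: All graphs are finite, undirected and simple (no loops, no multiple edges). The order of a graph is its number of vertices. For graphs $F$ and $G$ and a vertex $v\in V(G)$, the $F$-degree of $v$ in $G$ is the number of subgraphs of $G$ (not necessarily induced) that are isomorphic to $F$ and contain $v$. The graph $G$ is $F$-irregular if the $F$-degrees of its vertices are pairwise distinct. *)

theory Defs
  imports "Graph_Theory.Graph_Theory"
begin

text \<open>
  A finite simple graph is a \<open>pair_graph\<close>: a finite vertex set with an irreflexive, symmetric set
  of ordered pairs, so that each edge is represented by its two orientations. The library's
  \<open>subgraph\<close> also admits subsets of the arcs that are not symmetric, hence the requirement below
  that the copy of \<open>F\<close> is a \<open>pair_graph\<close> as well.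
\<close>

definition copies_at ::
  "'a pair_pre_digraph \<Rightarrow> 'b pair_pre_digraph \<Rightarrow> 'b \<Rightarrow> 'b pair_pre_digraph set" where
  "copies_at F G v =
    {H. pair_graph H \<and> subgraph (with_proj H) (with_proj G) \<and>
        digraph_iso (with_proj F) (with_proj H) \<and> v \<in> pverts H}"

definition F_degree :: "'a pair_pre_digraph \<Rightarrow> 'b pair_pre_digraph \<Rightarrow> 'b \<Rightarrow> nat" where
  "F_degree F G v = card (copies_at F G v)"

definition F_irregular :: "'a pair_pre_digraph \<Rightarrow> 'b pair_pre_digraph \<Rightarrow> bool" where
  "F_irregular F G \<longleftrightarrow> inj_on (F_degree F G) (pverts G)"

end

(*
  Every host graph is a split graph: a clique K = {1..t} together with an independent set J whose
  members j are joined to prescribed sets N j of clique vertices. If the neighbourhood of a vertex i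
  is contained in that of j, exchanging i for j maps the copies of F through i injectively to copies
  through j, so nested neighbourhoods give comparable F-degrees. If the sets N j are initial segments
  of K, the neighbourhoods form a chain, and only two kinds of ties remain: the clique vertices
  adjacent to all of J (as many as the minimum degree of F), and the bottom of the clique. A few
  modified sets N j break these ties.

  If F is complete, its copies are cliques, and the F-degrees are explicit sums of binomial
  coefficients. The modified sets trade one top vertex for the bottom vertex t, and the loss
  C(p, delta - 1) of a top vertex never equals a value C(m, delta) because p is a prime.

  If F is incomplete, the modified sets have exactly delta elements, so that every copy of F through
  such a vertex uses all of its neighbours. The remaining comparisons are settled by counting: the
  copies to which the exchange argument does not apply have one free vertex less than those it misses.
*)
theory Submission
  imports Defs "HOL-Computational_Algebra.Primes"
begin

section \<open>Embeddings and copies\<close>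

text \<open>An independent vertex with fewer than \<delta> neighbours (\<delta> the minimum degree
  of F) lies in no copy of F. So all sets \<open>N j\<close> have at least \<delta> elements, and a
  pure chain of initial segments cannot separate the first \<delta> clique vertices. Complete and
  incomplete patterns need different repairs. If F is complete of order k, then \<delta> = k - 1,
  and every independent vertex with exactly \<delta> neighbours has F-degree 1. Modified sets of
  size \<delta> would tie with each other, so modified sets replace chain members of distinct larger
  sizes, and the degrees are computed exactly. If F is incomplete, a vertex v of minimum degree has
  a neighbour x that is adjacent to some u outside the closed neighbourhood of v. Copies with v and
  u at two independent vertices are sensitive to which clique vertex x occupies, and this separates
  modified sets of equal size. The comparison is asymptotic: the order of the host is at most a
  constant times M, while each free pattern vertex has M choices, so one more free vertex outweighs
  every factor depending on F alone.\<close>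

definition graph_image :: "('a \<Rightarrow> 'b) \<Rightarrow> 'a pair_pre_digraph \<Rightarrow> 'b pair_pre_digraph" where
  "graph_image f F = \<lparr>pverts = f ` pverts F, parcs = map_prod f f ` parcs F\<rparr>"

text \<open>Extensional functions, so that an embedding is determined by its values on
  \<open>pverts F\<close> and the set is finite.\<close>

definition embs :: "'a pair_pre_digraph \<Rightarrow> 'b pair_pre_digraph \<Rightarrow> ('a \<Rightarrow> 'b) set" where
  "embs F G = {f \<in> pverts F \<rightarrow>\<^sub>E pverts G. inj_on f (pverts F) \<and>
     (\<forall>x y. (x, y) \<in> parcs F \<longrightarrow> (f x, f y) \<in> parcs G)}"

definition embs_at :: "'a pair_pre_digraph \<Rightarrow> 'b pair_pre_digraph \<Rightarrow> 'b \<Rightarrow> ('a \<Rightarrow> 'b) set" where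
  "embs_at F G v = {f \<in> embs F G. v \<in> f ` pverts F}"

lemma graph_image_sel [simp]:
  "pverts (graph_image f F) = f ` pverts F" "parcs (graph_image f F) = map_prod f f ` parcs F"
  by (auto simp: graph_image_def)

lemma pair_pre_digraph_eqI:
  "pverts G = pverts H \<Longrightarrow> parcs G = parcs H \<Longrightarrow> G = (H :: 'a pair_pre_digraph)"
  by simp

lemma pair_graph_iff:
  "pair_graph G \<longleftrightarrow> finite (pverts G) \<and> parcs G \<subseteq> pverts G \<times> pverts G \<and>
    (\<forall>x y. (x, y) \<in> parcs G \<longrightarrow> (y, x) \<in> parcs G \<and> x \<noteq> y)" (is "?L \<longleftrightarrow> ?R")
proof
  assume ?L
  then interpret pair_graph G .
  show ?R
    using pair_finite_verts arcs_symmetric in_arcsD1 in_arcsD2 no_loops' by fast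
next
  assume R: ?R
  then have "finite (parcs G)"
    by (meson finite_SigmaI finite_subset)
  with R show ?L
    by unfold_locales (auto simp: symmetric_def sym_def)
qed

text \<open>Tail and head are the projections on both sides, which forces the arc map of an
  isomorphism to be \<open>map_prod f f\<close> on the arcs, for its vertex map
  \<open>f\<close>.\<close>

lemma digraph_iso_iff:
  assumes "pair_graph F"
  shows "digraph_iso (with_proj F) (with_proj H) \<longleftrightarrow>
    (\<exists>f. inj_on f (pverts F) \<and> H = graph_image f F)" (is "?L \<longleftrightarrow> ?R")
proof
  assume ?L
  then obtain h where h: "pre_digraph.digraph_isomorphism (with_proj F) h"
    and H: "with_proj H = app_iso h (with_proj F)"
    by (auto simp: digraph_iso_def)
  have th: "iso_tail h = fst" "iso_head h = snd"
    using arg_cong[OF H, of tail] arg_cong[OF H, of head] by simp_all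
  have V: "pverts H = iso_verts h ` pverts F" and "parcs H = iso_arcs h ` parcs F"
    using arg_cong[OF H, of verts] arg_cong[OF H, of arcs] by simp_all
  moreover have "iso_arcs h a = map_prod (iso_verts h) (iso_verts h) a" if "a \<in> parcs F" for a
    using h that th by (auto simp: pre_digraph.digraph_isomorphism_def prod_eq_iff)
  ultimately have "H = graph_image (iso_verts h) F"
    by (auto intro!: pair_pre_digraph_eqI)
  moreover have "inj_on (iso_verts h) (pverts F)"
    using h by (auto simp: pre_digraph.digraph_isomorphism_def)
  ultimately show ?R by blast
next
  assume ?R
  then obtain f where f: "inj_on f (pverts F)" "H = graph_image f F" by blast
  interpret pair_graph F by fact
  have inj: "inj_on (map_prod f f) (parcs F)"
    by (rule inj_on_subset[OF map_prod_inj_on[OF f(1) f(1)]]) (use assms in \<open>auto simp: pair_graph_iff\<close>)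
  show ?L
    unfolding digraph_iso_def pre_digraph.digraph_isomorphism_def
    by (rule exI[of _ "\<lparr>iso_verts = f, iso_arcs = map_prod f f, iso_head = snd, iso_tail = fst\<rparr>"])
      (use f inj in \<open>auto simp: app_iso_def with_proj_def wf_digraph_wp_iff[unfolded with_proj_def]\<close>)
qed

lemma finite_embs:
  "pair_graph F \<Longrightarrow> pair_graph G \<Longrightarrow> finite (embs F G)"
  unfolding embs_def
  by (rule finite_subset[OF _ finite_PiE[of "pverts F" "\<lambda>_. pverts G"]]) (auto simp: pair_graph_iff)

lemma finite_embs_at:
  "pair_graph F \<Longrightarrow> pair_graph G \<Longrightarrow> finite (embs_at F G v)"
  unfolding embs_at_def by (simp add: finite_embs)

lemma copies_at_eq_image:
  assumes F: "pair_graph F" and G: "pair_graph G"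
  shows "copies_at F G v = (\<lambda>f. graph_image f F) ` embs_at F G v"
proof (intro equalityI subsetI)
  fix H assume "H \<in> copies_at F G v"
  then have H: "pair_graph H" "subgraph (with_proj H) (with_proj G)"
    "digraph_iso (with_proj F) (with_proj H)" "v \<in> pverts H"
    by (auto simp: copies_at_def)
  obtain f where f: "inj_on f (pverts F)" "H = graph_image f F"
    using H(3) digraph_iso_iff[OF F] by blast
  define g where "g = restrict f (pverts F)"
  have "graph_image g F = H"
    unfolding f(2) g_def using F
    by (intro pair_pre_digraph_eqI) (force simp: pair_graph_iff)+
  moreover have "g \<in> embs_at F G v"
  proof -
    have "(g x, g y) \<in> parcs G" if "(x, y) \<in> parcs F" for x y
    proof -
      have "(g x, g y) \<in> parcs H"
        using that \<open>graph_image g F = H\<close> by force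
      then show ?thesis using H(2) by (auto simp: subgraph_def)
    qed
    moreover have "g x \<in> pverts G" if "x \<in> pverts F" for x
      using that H(2) f(2) by (auto simp: subgraph_def g_def)
    ultimately show ?thesis
      using f H(4) by (auto simp: embs_at_def embs_def g_def inj_on_def)
  qed
  ultimately show "H \<in> (\<lambda>f. graph_image f F) ` embs_at F G v" by blast
next
  fix H assume "H \<in> (\<lambda>f. graph_image f F) ` embs_at F G v"
  then obtain f where f: "f \<in> embs F G" "v \<in> f ` pverts F" "H = graph_image f F"
    by (auto simp: embs_at_def)
  have H: "pair_graph H"
    unfolding pair_graph_iff
  proof (intro conjI allI impI)
    fix x y assume "(x, y) \<in> parcs H"
    then obtain a b where "(a, b) \<in> parcs F" "x = f a" "y = f b" using f(3) by auto
    moreover have "a \<noteq> b" "(b, a) \<in> parcs F" "a \<in> pverts F" "b \<in> pverts F"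
      using F \<open>(a, b) \<in> parcs F\<close> by (auto simp: pair_graph_iff)
    ultimately show "(y, x) \<in> parcs H" "x \<noteq> y"
      using f by (force simp: embs_def inj_on_def)+
  qed (use F f in \<open>auto simp: pair_graph_iff\<close>)
  interpret H: pair_graph H by fact
  interpret G: pair_graph G by fact
  have "subgraph (with_proj H) (with_proj G)"
    unfolding subgraph_def
    using f H.wf_digraph_axioms G.wf_digraph_axioms by (auto simp: embs_def)
  moreover have "digraph_iso (with_proj F) (with_proj H)"
    using f digraph_iso_iff[OF F] by (auto simp: embs_def)
  ultimately show "H \<in> copies_at F G v"
    using H f by (auto simp: copies_at_def)
qed

text \<open>An injective arc-preserving self-map of a finite graph is an automorphism, and two
  embeddings with the same image differ by a unique one.\<close>

lemma card_embs_fiber: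
  assumes F: "pair_graph F" and G: "pair_graph G" and g: "g \<in> embs F G"
  shows "card {f \<in> embs F G. graph_image f F = graph_image g F} = card (embs F F)"
proof -
  let ?V = "pverts F"
  have A: "parcs F \<subseteq> ?V \<times> ?V" "finite ?V" "finite (parcs F)"
    using F by (auto simp: pair_graph_iff intro: finite_subset)
  have g': "inj_on g ?V" "g \<in> ?V \<rightarrow>\<^sub>E pverts G" "\<And>x y. (x, y) \<in> parcs F \<Longrightarrow> (g x, g y) \<in> parcs G"
    using g by (auto simp: embs_def)
  have aut: "h ` ?V = ?V \<and> map_prod h h ` parcs F = parcs F" if "h \<in> embs F F" for h
  proof -
    have h: "inj_on h ?V" "h ` ?V \<subseteq> ?V" "map_prod h h ` parcs F \<subseteq> parcs F"
      using that by (auto simp: embs_def)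
    have "inj_on (map_prod h h) (parcs F)"
      by (rule inj_on_subset[OF map_prod_inj_on[OF h(1) h(1)] A(1)])
    then show ?thesis
      using h A by (simp add: endo_inj_surj)
  qed
  have "bij_betw (\<lambda>h. restrict (g \<circ> h) ?V) (embs F F)
     {f \<in> embs F G. graph_image f F = graph_image g F}"
  proof (rule bij_betwI')
    fix h h' assume hs: "h \<in> embs F F" "h' \<in> embs F F"
    show "(restrict (g \<circ> h) ?V = restrict (g \<circ> h') ?V) = (h = h')"
    proof
      assume eq: "restrict (g \<circ> h) ?V = restrict (g \<circ> h') ?V"
      show "h = h'"
      proof
        fix x
        show "h x = h' x"
        proof (cases "x \<in> ?V")
          case True
          then have "g (h x) = g (h' x)" using fun_cong[OF eq, of x] by simp
          moreover have "h x \<in> ?V" "h' x \<in> ?V" using hs True by (auto simp: embs_def)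
          ultimately show ?thesis using g'(1) by (auto dest: inj_onD)
        qed (use hs in \<open>auto simp: embs_def PiE_def extensional_def\<close>)
      qed
    qed simp
  next
    fix h assume h: "h \<in> embs F F"
    let ?f = "restrict (g \<circ> h) ?V"
    have h': "inj_on h ?V" "h \<in> ?V \<rightarrow>\<^sub>E ?V" "\<And>x y. (x, y) \<in> parcs F \<Longrightarrow> (h x, h y) \<in> parcs F"
      using h by (auto simp: embs_def)
    have "inj_on ?f ?V"
      using comp_inj_on[OF h'(1), of g] g'(1) aut[OF h] by simp
    moreover have "?f \<in> ?V \<rightarrow>\<^sub>E pverts G"
      using h'(2) g'(2) by auto
    moreover have "(?f x, ?f y) \<in> parcs G" if "(x, y) \<in> parcs F" for x y
      using that A(1) h'(3)[OF that] g'(3) by auto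
    moreover have "map_prod ?f ?f ` parcs F = map_prod g g ` (map_prod h h ` parcs F)"
      using A(1) by (force simp: image_image)
    then have "graph_image ?f F = graph_image g F"
      using aut[OF h] by (intro pair_pre_digraph_eqI) (auto simp: image_image[symmetric])
    ultimately show "?f \<in> {f \<in> embs F G. graph_image f F = graph_image g F}"
      by (auto simp: embs_def)
  next
    fix f assume "f \<in> {f \<in> embs F G. graph_image f F = graph_image g F}"
    then have f: "f \<in> embs F G" and eq: "graph_image f F = graph_image g F" by auto
    have im: "f ` ?V = g ` ?V" "map_prod f f ` parcs F = map_prod g g ` parcs F"
      using arg_cong[OF eq, of pverts] arg_cong[OF eq, of parcs] by simp_all
    define h where "h = restrict (\<lambda>x. the_inv_into ?V g (f x)) ?V"
    have h: "h x \<in> ?V" "g (h x) = f x" if "x \<in> ?V" for x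
    proof -
      have "f x \<in> g ` ?V" using that im by auto
      then show "h x \<in> ?V" "g (h x) = f x"
        using that g'(1) unfolding h_def
        by (auto simp: the_inv_into_into f_the_inv_into_f)
    qed
    have "inj_on h ?V"
    proof (rule inj_onI)
      fix x y assume "x \<in> ?V" "y \<in> ?V" "h x = h y"
      then have "f x = f y" using h(2) by metis
      then show "x = y" using f \<open>x \<in> ?V\<close> \<open>y \<in> ?V\<close> by (auto simp: embs_def dest: inj_onD)
    qed
    moreover have "(h x, h y) \<in> parcs F" if xy: "(x, y) \<in> parcs F" for x y
    proof -
      have V: "x \<in> ?V" "y \<in> ?V" using xy A(1) by auto
      have "(f x, f y) \<in> map_prod g g ` parcs F" using im xy by force
      then obtain a b where ab: "(a, b) \<in> parcs F" "g a = f x" "g b = f y" by auto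
      moreover have "a \<in> ?V" "b \<in> ?V" using ab A(1) by auto
      ultimately have "a = h x" "b = h y"
        using h V g'(1) by (metis inj_onD)+
      then show ?thesis using ab by simp
    qed
    ultimately have "h \<in> embs F F"
      using h by (auto simp: embs_def h_def)
    moreover have "f = restrict (g \<circ> h) ?V"
      using h f by (intro ext) (auto simp: embs_def PiE_def extensional_def)
    ultimately show "\<exists>h\<in>embs F F. f = restrict (g \<circ> h) ?V" by blast
  qed
  then show ?thesis by (simp add: bij_betw_same_card)
qed

lemma card_embs_at:
  assumes F: "pair_graph F" and G: "pair_graph G"
  shows "card (embs_at F G v) = card (embs F F) * F_degree F G v"
proof -
  let ?S = "embs_at F G v"
  let ?i = "\<lambda>f. graph_image f F"
  have "card ?S = (\<Sum>f\<in>?S. 1)" by simp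
  also have "\<dots> = (\<Sum>H\<in>?i ` ?S. \<Sum>f\<in>{f \<in> ?S. ?i f = H}. 1)"
    by (rule sum.image_gen[OF finite_embs_at[OF F G]])
  also have "\<dots> = (\<Sum>H\<in>?i ` ?S. card (embs F F))"
  proof (rule sum.cong[OF refl])
    fix H assume "H \<in> ?i ` ?S"
    then obtain g where g: "g \<in> ?S" "H = ?i g" by auto
    have "v \<in> f ` pverts F" if "?i f = ?i g" for f
      using g arg_cong[OF that, of pverts] by (auto simp: embs_at_def)
    then have "{f \<in> ?S. ?i f = H} = {f \<in> embs F G. ?i f = ?i g}"
      using g by (auto simp: embs_at_def)
    then show "(\<Sum>f\<in>{f \<in> ?S. ?i f = H}. 1) = card (embs F F)"
      using card_embs_fiber[OF F G, of g] g by (simp add: embs_at_def)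
  qed
  finally show ?thesis
    by (simp add: F_degree_def copies_at_eq_image[OF F G])
qed

text \<open>Embeddings replace copies at the price of a constant factor; exchanges of host vertices
  then act by composition.\<close>

lemma F_irregularI:
  assumes F: "pair_graph F" and G: "pair_graph G"
    and "inj_on (\<lambda>v. card (embs_at F G v)) (pverts G)"
  shows "F_irregular F G"
  using assms(3) unfolding F_irregular_def card_embs_at[OF F G]
  by (auto simp: inj_on_def)

lemma infinite_family_of_unbounded_order:
  fixes P :: "nat pair_pre_digraph \<Rightarrow> bool"
  assumes ex: "\<And>n. \<exists>G. pair_graph G \<and> P G \<and> n \<le> card (pverts G)"
  shows "\<exists>\<G>. infinite \<G> \<and> (\<forall>G\<in>\<G>. pair_graph G \<and> P G) \<and>
    pairwise (\<lambda>G H. \<not> digraph_iso (with_proj G) (with_proj H)) \<G>"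
proof -
  let ?Q = "\<lambda>G. pair_graph G \<and> P G"
  define N where "N = (\<lambda>G :: nat pair_pre_digraph. card (pverts G)) ` Collect ?Q"
  define g where "g n = (SOME G. ?Q G \<and> card (pverts G) = n)" for n
  have g: "?Q (g n) \<and> card (pverts (g n)) = n" if "n \<in> N" for n
    unfolding g_def by (rule someI_ex) (use that in \<open>auto simp: N_def\<close>)
  have "infinite N"
    unfolding infinite_nat_iff_unbounded_le N_def using ex by blast
  moreover have "inj_on g N"
    using g by (metis inj_onI)
  ultimately have "infinite (g ` N)" by (simp add: finite_image_iff)
  moreover have "pairwise (\<lambda>G H. \<not> digraph_iso (with_proj G) (with_proj H)) (g ` N)"
  proof (rule pairwiseI, rule notI)
    fix G H assume GH: "G \<in> g ` N" "H \<in> g ` N" "G \<noteq> H" "digraph_iso (with_proj G) (with_proj H)"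
    have "pair_graph G" using GH(1) g by auto
    from GH(4)[unfolded digraph_iso_iff[OF this]] obtain f
      where "inj_on f (pverts G)" "H = graph_image f G" by blast
    then have "card (pverts G) = card (pverts H)"
      by (simp add: card_image)
    then show False using GH(1-3) g by (metis imageE)
  qed
  ultimately show ?thesis using g by (intro exI[of _ "g ` N"]) auto
qed

section \<open>Exchange arguments in split graphs\<close>

text \<open>Common shape of the exchange comparisons: \<open>\<phi>\<close> exchanges vertices where
  this is possible, and the exceptions \<open>X - A\<close> are outnumbered by a set
  \<open>T\<close> that the exchange never reaches.\<close>

lemma card_less_by_injection:
  assumes fin: "finite X" "finite Y"
    and "A \<subseteq> X" "inj_on \<phi> A" "\<phi> ` A \<subseteq> Y" "T \<subseteq> Y" "T \<inter> \<phi> ` A = {}"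
    and less: "card (X - A) < card T"
  shows "card X < card Y"
proof -
  have "card X = card A + card (X - A)"
    using assms by (metis card_Diff_subset card_mono finite_subset le_add_diff_inverse)
  also have "\<dots> < card (\<phi> ` A) + card T"
    using less \<open>inj_on \<phi> A\<close> by (simp add: card_image)
  also have "\<dots> = card (\<phi> ` A \<union> T)"
    using assms by (metis Int_commute card_Un_disjoint finite_subset)
  also have "\<dots> \<le> card Y"
    using assms by (intro card_mono) auto
  finally show ?thesis .
qed

lemma inj_extend:
  assumes "finite A'" "finite B" "A \<subseteq> A'" "inj_on f A" "f ` A \<subseteq> B" "card A' \<le> card B"
  shows "\<exists>g. inj_on g A' \<and> g ` A' \<subseteq> B \<and> (\<forall>a\<in>A. g a = f a)"
proof -
  have fA: "finite A" using assms finite_subset by blast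
  have "card (A' - A) \<le> card (B - f ` A)"
    using assms fA by (simp add: card_Diff_subset card_image)
  then obtain h where h: "h ` (A' - A) \<subseteq> B - f ` A" "inj_on h (A' - A)"
    using card_le_inj[of "A' - A" "B - f ` A"] assms by auto
  let ?g = "\<lambda>a. if a \<in> A then f a else h a"
  have "inj_on ?g A'"
  proof (rule inj_onI)
    fix a b assume ab: "a \<in> A'" "b \<in> A'" "?g a = ?g b"
    have "h c \<noteq> f d" if "c \<in> A' - A" "d \<in> A" for c d
      using h(1) that by blast
    then have "a \<in> A \<longleftrightarrow> b \<in> A" using ab by (metis DiffI)
    then show "a = b"
      using ab assms(4) h(2) by (cases "a \<in> A") (auto dest: inj_onD)
  qed
  moreover have "?g ` A' \<subseteq> B" using assms(5) h(1) by auto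
  ultimately show ?thesis by (intro exI[of _ ?g]) auto
qed

text \<open>The source of lower bounds: \<open>g\<close> fixes some pattern vertices, and those in
  \<open>V\<^sub>0\<close> vary independently.\<close>

lemma power_le_card_of_choices:
  assumes "finite T" "finite V\<^sub>0"
    and "\<And>c. c \<in> Pi\<^sub>E V\<^sub>0 B \<Longrightarrow> (\<lambda>x. if x \<in> V\<^sub>0 then c x else g x) \<in> T"
    and "\<And>x. x \<in> V\<^sub>0 \<Longrightarrow> card (B x) = M"
  shows "M ^ card V\<^sub>0 \<le> card T"
proof -
  let ?h = "\<lambda>c x. if x \<in> V\<^sub>0 then c x else g x"
  have "inj_on ?h (Pi\<^sub>E V\<^sub>0 B)"
  proof (rule inj_onI)
    fix c d assume "c \<in> Pi\<^sub>E V\<^sub>0 B" "d \<in> Pi\<^sub>E V\<^sub>0 B" "?h c = ?h d"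
    then show "c = d"
      by (intro PiE_ext[of c V\<^sub>0 B d]) (auto dest: fun_cong split: if_splits)
  qed
  moreover have "?h ` Pi\<^sub>E V\<^sub>0 B \<subseteq> T" using assms(3) by blast
  ultimately have "card (Pi\<^sub>E V\<^sub>0 B) \<le> card T"
    using assms(1) by (rule card_inj_on_le)
  then show ?thesis using assms(2,4) by (simp add: card_PiE)
qed

section \<open>Exchange maps acting on embeddings\<close>

definition nbs :: "'a pair_pre_digraph \<Rightarrow> 'a \<Rightarrow> 'a set" where
  "nbs F x = {y. (x, y) \<in> parcs F}"

lemma embsD:
  assumes "f \<in> embs F G"
  shows "f \<in> pverts F \<rightarrow>\<^sub>E pverts G" "inj_on f (pverts F)"
    "\<And>x y. (x, y) \<in> parcs F \<Longrightarrow> (f x, f y) \<in> parcs G"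
  using assms by (auto simp: embs_def)

lemma compose_in_embs:
  assumes F: "pair_graph F" and f: "f \<in> embs F G"
    and inj: "inj_on \<pi> W" and W: "f ` pverts F \<subseteq> W"
    and arc: "\<And>u w. u \<in> f ` pverts F \<Longrightarrow> w \<in> f ` pverts F \<Longrightarrow> (u, w) \<in> parcs G \<Longrightarrow>
      (\<pi> u, \<pi> w) \<in> parcs G"
    and vert: "\<And>u. u \<in> f ` pverts F \<Longrightarrow> \<pi> u \<in> pverts G"
  shows "compose (pverts F) \<pi> f \<in> embs F G"
proof -
  have "parcs F \<subseteq> pverts F \<times> pverts F" using F by (auto simp: pair_graph_iff)
  moreover have "inj_on (compose (pverts F) \<pi> f) (pverts F)"
    using comp_inj_on[OF embsD(2)[OF f] inj_on_subset[OF inj W]] by (simp add: compose_def inj_on_def)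
  ultimately show ?thesis
    using embsD[OF f] arc vert by (auto simp: embs_def compose_def)
qed

lemma inj_on_compose:
  assumes inj: "inj_on \<pi> W" and A: "\<And>f. f \<in> A \<Longrightarrow> f \<in> embs F G \<and> f ` pverts F \<subseteq> W"
  shows "inj_on (compose (pverts F) \<pi>) A"
proof (rule inj_onI)
  fix f g assume fg: "f \<in> A" "g \<in> A" and eq: "compose (pverts F) \<pi> f = compose (pverts F) \<pi> g"
  have "f x = g x" if "x \<in> pverts F" for x
  proof -
    have "\<pi> (f x) = \<pi> (g x)" using fun_cong[OF eq, of x] that by (simp add: compose_def)
    then show ?thesis using A[OF fg(1)] A[OF fg(2)] that inj by (auto dest!: inj_onD)
  qed
  then show "f = g"
    using A[OF fg(1)] A[OF fg(2)]
    by (intro PiE_ext[of f "pverts F" "\<lambda>_. pverts G" g]) (auto simp: embs_def)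
qed

text \<open>Embeddings through both \<open>i\<close> and \<open>j\<close> count on both sides and
  cancel.\<close>

lemma card_embs_at_less:
  assumes F: "pair_graph F" and G: "pair_graph G"
    and "card {f \<in> embs_at F G i. j \<notin> f ` pverts F} < card {f \<in> embs_at F G j. i \<notin> f ` pverts F}"
  shows "card (embs_at F G i) < card (embs_at F G j)"
proof -
  have split: "card (embs_at F G a) = card (embs_at F G a \<inter> embs_at F G b)
      + card {f \<in> embs_at F G a. b \<notin> f ` pverts F}" for a b
    by (subst card_Un_disjoint[symmetric])
      (auto simp: finite_embs[OF F G] embs_at_def intro!: arg_cong[of _ _ card])
  show ?thesis
    using assms(3) split[of i j] split[of j i] by (simp add: Int_commute)
qed

text \<open>Sending \<open>i\<close> to \<open>j\<close> turns embeddings through \<open>i\<close>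
  alone into embeddings through \<open>j\<close> alone. It never produces \<open>f\<close>: a
  preimage would have \<open>x\<close> at \<open>i\<close> and \<open>y\<close> at
  \<open>f y\<close>, which are not adjacent.\<close>

lemma embs_at_nested_less:
  assumes F: "pair_graph F" and G: "pair_graph G" and ij: "i \<noteq> j" "j \<in> pverts G"
    and nested: "\<And>w. (i, w) \<in> parcs G \<Longrightarrow> w \<noteq> j \<Longrightarrow> (j, w) \<in> parcs G"
    and f: "f \<in> embs F G" "i \<notin> f ` pverts F" "(x, y) \<in> parcs F" "f x = j" "(i, f y) \<notin> parcs G"
  shows "card (embs_at F G i) < card (embs_at F G j)"
proof (rule card_embs_at_less[OF F G])
  let ?X = "{f \<in> embs_at F G i. j \<notin> f ` pverts F}"
  let ?Y = "{f \<in> embs_at F G j. i \<notin> f ` pverts F}"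
  let ?W = "UNIV - {j}"
  let ?\<pi> = "id(i := j)"
  have fin: "finite ?X" "finite ?Y" using finite_embs_at[OF F G] by auto
  have A: "parcs F \<subseteq> pverts F \<times> pverts F" and sym: "(u, w) \<in> parcs G \<Longrightarrow> (w, u) \<in> parcs G" 
    and irrefl: "(u, u) \<notin> parcs G" for u w
    using F G by (auto simp: pair_graph_iff)
  have inj: "inj_on ?\<pi> ?W" using ij by (auto simp: inj_on_def)
  have "compose (pverts F) ?\<pi> g \<in> ?Y - {f}" if g: "g \<in> ?X" for g
  proof -
    have g': "g \<in> embs F G" "g ` pverts F \<subseteq> ?W" using g by (auto simp: embs_at_def)
    have "compose (pverts F) ?\<pi> g \<in> embs F G"
    proof (rule compose_in_embs[OF F g'(1) inj g'(2)])
      fix u w assume uw: "u \<in> g ` pverts F" "w \<in> g ` pverts F" "(u, w) \<in> parcs G"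
      then have "u \<noteq> j" "w \<noteq> j" "u \<noteq> w" using g'(2) irrefl by auto
      moreover have "(w, u) \<in> parcs G" using sym uw(3) .
      ultimately show "(?\<pi> u, ?\<pi> w) \<in> parcs G"
        using uw(3) nested sym[OF nested] by (cases "u = i"; cases "w = i") auto
    next
      fix u assume "u \<in> g ` pverts F"
      then show "?\<pi> u \<in> pverts G" using embsD(1)[OF g'(1)] ij by auto
    qed
    moreover have "compose (pverts F) ?\<pi> g x \<noteq> j \<or> compose (pverts F) ?\<pi> g y \<noteq> f y"
    proof (rule ccontr)
      assume *: "\<not> ?thesis"
      have xy: "x \<in> pverts F" "y \<in> pverts F" "x \<noteq> y" using A f(3) F by (auto simp: pair_graph_iff)
      have "g x \<noteq> j" "g y \<noteq> j" using g xy by auto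
      then have gx: "g x = i" using * xy by (auto simp: compose_def split: if_splits)
      then have "g y \<noteq> i" using xy embsD(2)[OF g'(1)] by (auto dest: inj_onD)
      then have "g y = f y" using * xy by (auto simp: compose_def)
      then show False using embsD(3)[OF g'(1) f(3)] gx f(5) by simp
    qed
    moreover have "compose (pverts F) ?\<pi> g ` pverts F = ?\<pi> ` g ` pverts F"
      by (simp only: compose_def image_restrict_eq image_image)
    moreover have "i \<in> g ` pverts F" using g by (simp add: embs_at_def)
    ultimately show ?thesis
      using ij f(4) by (auto simp: embs_at_def image_iff)
  qed
  then have img: "compose (pverts F) ?\<pi> ` ?X \<subseteq> ?Y" "{f} \<inter> compose (pverts F) ?\<pi> ` ?X = {}"
    by auto
  have "f \<in> ?Y" using f A by (auto simp: embs_at_def)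
  moreover have "inj_on (compose (pverts F) ?\<pi>) ?X"
    by (rule inj_on_compose[OF inj, of _ F G]) (auto simp: embs_at_def)
  ultimately show "card ?X < card ?Y"
    using card_less_by_injection[OF fin subset_refl _ img(1) _ img(2)] by simp
qed

text \<open>The source of upper bounds: choose a preimage for each point of \<open>S\<close>, then
  place the remaining pattern vertices arbitrarily.\<close>

lemma card_embs_covering_le:
  assumes F: "pair_graph F" and G: "pair_graph G" and S: "finite S"
  shows "card {f \<in> embs F G. S \<subseteq> f ` pverts F} \<le>
    card (pverts F) ^ card S * card (pverts G) ^ (card (pverts F) - card S)"
proof -
  let ?V = "pverts F" and ?U = "pverts G"
  let ?X = "{f \<in> embs F G. S \<subseteq> f ` ?V}"
  have V: "finite ?V" and U: "finite ?U" using F G by (auto simp: pair_graph_iff)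
  let ?P = "{h \<in> S \<rightarrow>\<^sub>E ?V. inj_on h S}"
  let ?Q = "\<lambda>h. (?V - h ` S) \<rightarrow>\<^sub>E ?U"
  let ?s = "\<lambda>f. restrict (inv_into ?V f) S"
  let ?\<Phi> = "\<lambda>f. (?s f, restrict f (?V - ?s f ` S))"
  have finP: "finite ?P"
    by (rule finite_subset[OF _ finite_PiE[OF S, of "\<lambda>_. ?V"]]) (use V in auto)
  have sec: "f (?s f a) = a" "?s f a \<in> ?V" if "f \<in> ?X" "a \<in> S" for f a
  proof -
    have "a \<in> f ` ?V" using that by auto
    then show "f (?s f a) = a" "?s f a \<in> ?V"
      using that by (auto simp: f_inv_into_f inv_into_into)
  qed
  have "?\<Phi> f \<in> Sigma ?P ?Q" if f: "f \<in> ?X" for f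
  proof -
    have "inj_on (?s f) S" using sec[OF f] by (metis inj_onI)
    moreover have "?s f \<in> S \<rightarrow>\<^sub>E ?V" using sec[OF f] by auto
    ultimately show ?thesis using f embsD(1)[of f F G] by auto
  qed
  moreover have "inj_on ?\<Phi> ?X"
  proof (rule inj_onI)
    fix f g assume f: "f \<in> ?X" and g: "g \<in> ?X" and eq: "?\<Phi> f = ?\<Phi> g"
    have s: "?s f = ?s g" using eq by (rule Pair_inject)
    have "restrict f (?V - ?s f ` S) = restrict g (?V - ?s g ` S)" using eq by (rule Pair_inject)
    then have r: "restrict f (?V - ?s f ` S) = restrict g (?V - ?s f ` S)"
      by (simp only: s)
    have "f x = g x" if x: "x \<in> ?V" for x
    proof (cases "x \<in> ?s f ` S")
      case True
      then obtain a where a: "a \<in> S" "x = ?s f a" by blast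
      then show ?thesis using sec(1)[OF f a(1)] sec(1)[OF g a(1)] s by metis
    next
      case False
      then show ?thesis using fun_cong[OF r, of x] x by (simp del: restrict_apply add: restrict_def)
    qed
    then show "f = g"
      using f g by (intro PiE_ext[of f ?V "\<lambda>_. ?U" g]) (auto simp: embs_def)
  qed
  moreover have fin: "finite (Sigma ?P ?Q)"
    using finP V U by (intro finite_SigmaI finite_PiE) auto
  ultimately have "card ?X \<le> card (Sigma ?P ?Q)"
    by (intro card_inj_on_le[of ?\<Phi>]) blast+
  also have "\<dots> = (\<Sum>h\<in>?P. card (?Q h))"
    using finP V U by (intro card_SigmaI) (auto intro!: finite_PiE)
  also have "\<dots> = (\<Sum>h\<in>?P. card ?U ^ (card ?V - card S))"
  proof (rule sum.cong[OF refl])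
    fix h assume "h \<in> ?P"
    then have "card (?V - h ` S) = card ?V - card S"
      using V S by (subst card_Diff_subset) (auto simp: card_image)
    then show "card (?Q h) = card ?U ^ (card ?V - card S)"
      using V by (simp add: card_funcsetE)
  qed
  also have "\<dots> = card ?P * card ?U ^ (card ?V - card S)" by simp
  also have "card ?P \<le> card (S \<rightarrow>\<^sub>E ?V)"
    using S V by (intro card_mono finite_PiE) auto
  also have "card (S \<rightarrow>\<^sub>E ?V) = card ?V ^ card S" using S by (simp add: card_funcsetE)
  finally show ?thesis by simp
qed

section \<open>Split graphs with nested neighbourhoods\<close>

definition split_graph :: "'b set \<Rightarrow> 'b set \<Rightarrow> ('b \<Rightarrow> 'b set) \<Rightarrow> 'b pair_pre_digraph" where
  "split_graph K J N = \<lparr>pverts = K \<union> J,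
     parcs = {(u, w). u \<noteq> w \<and> (u \<in> K \<and> w \<in> K \<or> u \<in> J \<and> w \<in> N u \<or> w \<in> J \<and> u \<in> N w)}\<rparr>"

text \<open>The degree of \<open>v\<close> is small enough to place it at any member of
  \<open>J\<close>; \<open>big\<close> leaves room for the other pattern vertices in the clique even
  if one clique vertex is to be avoided.\<close>

locale split_host =
  fixes F :: "'a pair_pre_digraph" and K J :: "'b set" and N :: "'b \<Rightarrow> 'b set" and v :: 'a
  assumes F: "pair_graph F" and v: "v \<in> pverts F" "nbs F v \<noteq> {}"
    and fin: "finite K" "finite J" and disj: "K \<inter> J = {}"
    and N: "\<And>j. j \<in> J \<Longrightarrow> N j \<subseteq> K"
    and deg: "\<And>j. j \<in> J \<Longrightarrow> card (nbs F v) \<le> card (N j)"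
    and big: "card (pverts F) \<le> card K"
begin

abbreviation "H \<equiv> split_graph K J N"
abbreviation "D u \<equiv> card (embs_at F H u)"

lemma pverts_H [simp]: "pverts H = K \<union> J"
  by (simp add: split_graph_def)

lemma arc_H_iff: "(u, w) \<in> parcs H \<longleftrightarrow>
    u \<noteq> w \<and> (u \<in> K \<and> w \<in> K \<or> u \<in> J \<and> w \<in> N u \<or> w \<in> J \<and> u \<in> N w)"
  by (simp add: split_graph_def)

lemma H: "pair_graph H"
  using fin N[THEN subsetD] by (auto simp: pair_graph_iff arc_H_iff)

lemma F_arc: "(x, y) \<in> parcs F \<Longrightarrow> x \<in> pverts F \<and> y \<in> pverts F \<and> (y, x) \<in> parcs F \<and> x \<noteq> y"
  using F by (auto simp: pair_graph_iff)

lemma fin_F: "finite (pverts F)"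
  using F by (auto simp: pair_graph_iff)

lemma nbs_subset: "nbs F x \<subseteq> pverts F - {x}"
  using F_arc by (auto simp: nbs_def)

text \<open>Arcs inside the clique are preserved by injectivity alone, and as each edge has both
  orientations, only arcs whose tail goes to \<open>J\<close> impose a condition.\<close>

lemma embs_H_iff:
  "f \<in> embs F H \<longleftrightarrow> f \<in> pverts F \<rightarrow>\<^sub>E K \<union> J \<and> inj_on f (pverts F) \<and>
    (\<forall>x y. (x, y) \<in> parcs F \<longrightarrow> f x \<in> J \<longrightarrow> f y \<in> N (f x))" (is "?L \<longleftrightarrow> ?R")
proof
  assume L: ?L
  have "f y \<in> N (f x)" if "(x, y) \<in> parcs F" "f x \<in> J" for x y
    using embsD(3)[OF L that(1)] that(2) disj N by (auto simp: arc_H_iff)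
  then show ?R using embsD(1,2)[OF L] by auto
next
  assume R: ?R
  have "(f x, f y) \<in> parcs H" if xy: "(x, y) \<in> parcs F" for x y
  proof -
    have "f x \<noteq> f y" using F_arc[OF xy] R by (auto dest: inj_onD)
    moreover have "f x \<in> K \<union> J" "f y \<in> K \<union> J" using F_arc[OF xy] R by auto
    ultimately show ?thesis
      using R xy F_arc[OF xy] by (auto simp: arc_H_iff)
  qed
  then show ?L using R by (auto simp: embs_def)
qed

text \<open>Put \<open>v\<close> at \<open>j\<close>, its neighbours into \<open>N j\<close>, and
  all other vertices into the clique. Such embeddings make the nested comparisons strict.\<close>

lemma ex_emb_through_arc:
  assumes j: "j \<in> J" and s: "s \<in> N j" and i: "i \<noteq> j" "i \<notin> N j" and x: "x \<in> nbs F v"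
  shows "\<exists>f \<in> embs F H. f v = j \<and> f x = s \<and> i \<notin> f ` pverts F"
proof -
  have fN: "finite (N j)" using N[OF j] fin finite_subset by blast
  have "\<exists>g. inj_on g (nbs F v) \<and> g ` nbs F v \<subseteq> N j \<and> (\<forall>a\<in>{x}. g a = (\<lambda>_. s) a)"
    using x s deg[OF j] fN nbs_subset fin_F by (intro inj_extend) (auto intro: finite_subset)
  then obtain g where g: "inj_on g (nbs F v)" "g ` nbs F v \<subseteq> N j" "g x = s" by auto
  have "card (pverts F - {v}) \<le> card (K - {i})"
    using big v fin_F fin by (cases "i \<in> K") auto
  then have "\<exists>h. inj_on h (pverts F - {v}) \<and> h ` (pverts F - {v}) \<subseteq> K - {i} \<and> (\<forall>a\<in>nbs F v. h a = g a)"
    using g N[OF j] i fin fin_F nbs_subset by (intro inj_extend) auto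
  then obtain h where h: "inj_on h (pverts F - {v})" "h ` (pverts F - {v}) \<subseteq> K - {i}"
    "\<And>a. a \<in> nbs F v \<Longrightarrow> h a = g a" by blast
  define f where "f = restrict (h(v := j)) (pverts F)"
  have "j \<notin> K" using j disj by auto
  then have "inj_on f (pverts F)"
    using h(1,2) unfolding inj_on_def f_def by (auto simp: image_subset_iff)
  moreover have "f \<in> pverts F \<rightarrow>\<^sub>E K \<union> J" using h(2) j by (auto simp: f_def image_subset_iff)
  moreover have "f b \<in> N (f a)" if "(a, b) \<in> parcs F" "f a \<in> J" for a b
  proof -
    have "a = v" using that h(2) F_arc[OF that(1)] disj by (auto simp: f_def split: if_splits)
    then show ?thesis using that F_arc[OF that(1)] h(3)[of b] g(2) by (auto simp: nbs_def f_def)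
  qed
  ultimately have f: "f \<in> embs F H" by (simp add: embs_H_iff)
  have "f v = j" using v by (simp add: f_def)
  moreover have "f x = s" using h(3)[OF x] g(3) nbs_subset[of v] x by (auto simp: f_def)
  moreover have "i \<notin> f ` pverts F"
    using h(2) i(1) by (auto simp: f_def image_iff image_subset_iff split: if_splits)
  ultimately have "f v = j \<and> f x = s \<and> i \<notin> f ` pverts F" by (intro conjI)
  then show ?thesis using f by blast
qed

lemma D_clique_less:
  assumes "i \<in> K" "s \<in> K" and sub: "{j \<in> J. i \<in> N j} \<subset> {j \<in> J. s \<in> N j}"
  shows "D i < D s"
proof -
  obtain j where j: "j \<in> J" "s \<in> N j" "i \<notin> N j" using sub by blast
  obtain x where x: "x \<in> nbs F v" using v by auto
  have "i \<noteq> j" using assms j disj by auto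
  then obtain f where f: "f \<in> embs F H" "f v = j" "f x = s" "i \<notin> f ` pverts F"
    using ex_emb_through_arc[OF j(1,2) _ j(3) x] by blast
  have "(x, v) \<in> parcs F" using x F_arc by (auto simp: nbs_def)
  moreover have "(i, f v) \<notin> parcs H" using f(2) j assms(1) disj N by (auto simp: arc_H_iff)
  moreover have "i \<noteq> s" using j by auto
  moreover have "(s, w) \<in> parcs H" if "(i, w) \<in> parcs H" "w \<noteq> s" for w
    using that assms disj by (auto simp: arc_H_iff)
  ultimately show ?thesis
    using f assms(2)
    by (intro embs_at_nested_less[OF F H, of i s f x v]) simp_all
qed

lemma D_indep_less:
  assumes "j \<in> J" "j' \<in> J" and sub: "N j' \<subset> N j"
  shows "D j' < D j"
proof -
  obtain s where s: "s \<in> N j" "s \<notin> N j'" using sub by blast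
  obtain x where x: "x \<in> nbs F v" using v by auto
  have "j' \<notin> N j" using assms N disj by auto
  then obtain f where f: "f \<in> embs F H" "f v = j" "f x = s" "j' \<notin> f ` pverts F"
    using ex_emb_through_arc[OF assms(1) s(1) _ _ x, of j'] sub by auto
  have "(v, x) \<in> parcs F" using x by (auto simp: nbs_def)
  moreover have "s \<in> K" using s N assms by auto
  then have "(j', f x) \<notin> parcs H" using f(3) s assms(1,2) disj by (auto simp: arc_H_iff)
  moreover have "j' \<noteq> j" using s by auto
  moreover have "(j, w) \<in> parcs H" if "(j', w) \<in> parcs H" "w \<noteq> j" for w
    using that assms disj N by (auto simp: arc_H_iff)
  ultimately show ?thesis
    using f assms(1)
    by (intro embs_at_nested_less[OF F H, of j' j f v x]) simp_all
qed

text \<open>Neighbours of \<open>j\<close> other than \<open>s\<close> are neighbours of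
  \<open>s\<close>. Strictness comes from an embedding inside \<open>K\<close> that uses the edge
  between \<open>s\<close> and \<open>w\<close>.\<close>

lemma D_indep_less_clique:
  assumes j: "j \<in> J" and s: "s \<in> K" and w: "w \<in> K" "w \<noteq> s" "w \<notin> N j"
  shows "D j < D s"
proof -
  obtain x where x: "x \<in> nbs F v" using v by auto
  have vx: "(v, x) \<in> parcs F" using x by (auto simp: nbs_def)
  have "\<exists>h. inj_on h (pverts F) \<and> h ` pverts F \<subseteq> K \<and> (\<forall>a\<in>{v, x}. h a = (if a = v then s else w))"
    using assms F_arc[OF vx] fin_F fin big by (intro inj_extend) (auto simp: inj_on_def)
  then obtain h where h: "inj_on h (pverts F)" "h ` pverts F \<subseteq> K" "h v = s" "h x = w"
    using F_arc[OF vx] by auto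
  let ?f = "restrict h (pverts F)"
  have "?f x \<notin> J" if "x \<in> pverts F" for x
    using that h(2) disj by auto
  then have f: "?f \<in> embs F H"
    unfolding embs_H_iff using h(1,2) F_arc by (auto simp del: restrict_apply)
  have j': "j \<notin> ?f ` pverts F" using h(2) j disj by auto
  have arc: "(j, ?f x) \<notin> parcs H"
    using F_arc[OF vx] h(4) w j disj N[of w] by (auto simp: arc_H_iff)
  have fv: "?f v = s" using h(3) v by simp
  have "j \<noteq> s" using j s disj by auto
  moreover have "(s, u) \<in> parcs H" if "(j, u) \<in> parcs H" "u \<noteq> s" for u
    using that j s disj N by (auto simp: arc_H_iff)
  moreover have "s \<in> pverts H" using s by simp
  ultimately show ?thesis
    by (intro embs_at_nested_less[OF F H _ _ _ f j' vx fv arc])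
qed

end

section \<open>Complete patterns\<close>

lemma inj_on_insert:
  assumes "j \<notin> A"
  shows "inj_on (insert j) {S. S \<subseteq> A \<and> P S}"
proof (rule inj_onI)
  fix S T assume "S \<in> {S. S \<subseteq> A \<and> P S}" "T \<in> {S. S \<subseteq> A \<and> P S}" "insert j S = insert j T"
  moreover from this have "j \<notin> S" "j \<notin> T" using assms by auto
  ultimately show "S = T" by (metis insert_ident)
qed

lemma card_subsets_containing:
  assumes "finite A" "p \<in> A" "0 < m"
  shows "card {S. S \<subseteq> A \<and> card S = m \<and> p \<in> S} = (card A - 1) choose (m - 1)"
proof -
  have "bij_betw (insert p) {S. S \<subseteq> A - {p} \<and> card S = m - 1} {S. S \<subseteq> A \<and> card S = m \<and> p \<in> S}"
  proof (rule bij_betwI[where g = "\<lambda>S. S - {p}"])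
    show "insert p \<in> {S. S \<subseteq> A - {p} \<and> card S = m - 1} \<rightarrow> {S. S \<subseteq> A \<and> card S = m \<and> p \<in> S}"
    proof
      fix S assume "S \<in> {S. S \<subseteq> A - {p} \<and> card S = m - 1}"
      then have "S \<subseteq> A - {p}" "card S = m - 1" "finite S" "p \<notin> S"
        using assms(1) by (auto intro: finite_subset)
      then show "insert p S \<in> {S. S \<subseteq> A \<and> card S = m \<and> p \<in> S}"
        using assms by auto
    qed
  qed (use assms in \<open>auto simp: card_Diff_singleton\<close>)
  then have "card {S. S \<subseteq> A \<and> card S = m \<and> p \<in> S} = card {S. S \<subseteq> A - {p} \<and> card S = m - 1}"
    by (simp add: bij_betw_same_card)
  then show ?thesis using assms by (simp add: n_subsets)
qed

section \<open>Copies of a complete graph as cliques\<close>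

definition cliques_at :: "'b pair_pre_digraph \<Rightarrow> nat \<Rightarrow> 'b \<Rightarrow> 'b set set" where
  "cliques_at G k u = {C. C \<subseteq> pverts G \<and> card C = k \<and> u \<in> C \<and>
     (\<forall>x\<in>C. \<forall>y\<in>C. x \<noteq> y \<longrightarrow> (x, y) \<in> parcs G)}"

lemma F_degree_complete:
  assumes F: "pair_graph F" and G: "pair_graph G"
    and complete: "\<And>x y. x \<in> pverts F \<Longrightarrow> y \<in> pverts F \<Longrightarrow> x \<noteq> y \<Longrightarrow> (x, y) \<in> parcs F"
  shows "F_degree F G u = card (cliques_at G (card (pverts F)) u)"
proof -
  let ?V = "pverts F"
  have arcs: "parcs F = {(x, y). x \<in> ?V \<and> y \<in> ?V \<and> x \<noteq> y}"
    using F complete by (auto simp: pair_graph_iff)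
  have V: "finite ?V" using F by (auto simp: pair_graph_iff)
  have parcs_H: "parcs H = {(a, b). a \<in> pverts H \<and> b \<in> pverts H \<and> a \<noteq> b}"
    if "H \<in> copies_at F G u" for H
  proof -
    obtain f where f: "f \<in> embs F G" "H = graph_image f F"
      using \<open>H \<in> copies_at F G u\<close> by (auto simp: copies_at_eq_image[OF F G] embs_at_def)
    show ?thesis
      using embsD(2)[OF f(1)] unfolding f(2) graph_image_sel arcs
      by (fastforce simp: image_iff dest: inj_onD)
  qed
  then have inj: "inj_on pverts (copies_at F G u)"
    by (intro inj_onI pair_pre_digraph_eqI) auto
  have "pverts ` copies_at F G u = (\<lambda>f. f ` ?V) ` embs_at F G u"
    by (simp add: copies_at_eq_image[OF F G] image_image)
  also have "\<dots> = cliques_at G (card ?V) u"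
  proof (intro equalityI subsetI)
    fix C assume "C \<in> (\<lambda>f. f ` ?V) ` embs_at F G u"
    then obtain f where f: "f \<in> embs F G" "u \<in> f ` ?V" "C = f ` ?V"
      by (auto simp: embs_at_def)
    have "(f x, f y) \<in> parcs G" if "x \<in> ?V" "y \<in> ?V" "f x \<noteq> f y" for x y
      using embsD(3)[OF f(1) complete] that by auto
    then show "C \<in> cliques_at G (card ?V) u"
      using f embsD(1,2)[OF f(1)] by (auto simp: cliques_at_def card_image)
  next
    fix C assume C: "C \<in> cliques_at G (card ?V) u"
    then have "finite C" using G by (auto simp: cliques_at_def pair_graph_iff intro: finite_subset)
    then obtain g where g: "bij_betw g ?V C"
      using C V finite_same_card_bij[of ?V C] by (auto simp: cliques_at_def)
    let ?f = "restrict g ?V"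
    have im: "?f ` ?V = C" using g by (simp add: bij_betw_def)
    have inj: "inj_on ?f ?V" using g by (simp add: bij_betw_def)
    have "(?f x, ?f y) \<in> parcs G" if "(x, y) \<in> parcs F" for x y
    proof -
      have xy: "x \<in> ?V" "y \<in> ?V" "x \<noteq> y" using that arcs by auto
      then have "?f x \<in> C" "?f y \<in> C" "?f x \<noteq> ?f y" using im inj by (blast dest: inj_onD)+
      then show ?thesis using C unfolding cliques_at_def by blast
    qed
    moreover have "?f \<in> ?V \<rightarrow>\<^sub>E pverts G"
      using im C unfolding cliques_at_def by (intro PiE_I) (blast, simp)
    ultimately have "?f \<in> embs_at F G u"
      using inj im C unfolding embs_at_def embs_def cliques_at_def by blast
    then show "C \<in> (\<lambda>f. f ` ?V) ` embs_at F G u" using im by blast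
  qed
  finally show ?thesis
    using card_image[OF inj] by (simp add: F_degree_def)
qed

lemma pair_graph_split_graph:
  assumes "finite K" "finite J" "\<And>j. j \<in> J \<Longrightarrow> N j \<subseteq> K"
  shows "pair_graph (split_graph K J N)"
  using assms(1,2) assms(3)[THEN subsetD] by (auto simp: pair_graph_iff split_graph_def)

context
  fixes K J :: "'b set" and N :: "'b \<Rightarrow> 'b set" and m :: nat
  assumes fin: "finite K" "finite J" and disj: "K \<inter> J = {}"
    and N: "\<And>j. j \<in> J \<Longrightarrow> N j \<subseteq> K" and m: "0 < m"
begin

text \<open>A clique contains at most one vertex of the independent set \<open>J\<close>.\<close>

lemma cliques_at_split_graph:
  "cliques_at (split_graph K J N) (Suc m) u =
    {C. C \<subseteq> K \<and> card C = Suc m \<and> u \<in> C} \<union>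
    (\<Union>j\<in>J. insert j ` {S. S \<subseteq> N j \<and> card S = m \<and> (u \<in> S \<or> u = j)})" (is "?L = ?R")
proof (intro equalityI subsetI)
  fix C assume C: "C \<in> ?L"
  then have C': "C \<subseteq> K \<union> J" "card C = Suc m" "u \<in> C" and
    clique: "\<And>x y. x \<in> C \<Longrightarrow> y \<in> C \<Longrightarrow> x \<noteq> y \<Longrightarrow> (x, y) \<in> parcs (split_graph K J N)"
    by (auto simp: cliques_at_def split_graph_def)
  show "C \<in> ?R"
  proof (cases "C \<subseteq> K")
    case False
    then obtain j where j: "j \<in> C" "j \<in> J" using C' by auto
    have "C - {j} \<subseteq> N j"
      using clique[OF j(1)] j(2) disj N by (fastforce simp: split_graph_def)
    moreover have "card (C - {j}) = m" using C' j by simp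
    moreover have "C = insert j (C - {j})" using j by auto
    ultimately show ?thesis using j C'(3) by blast
  qed (use C' in auto)
next
  fix C assume "C \<in> ?R"
  then consider "C \<subseteq> K" "card C = Suc m" "u \<in> C"
    | j S where "j \<in> J" "S \<subseteq> N j" "card S = m" "u \<in> S \<or> u = j" "C = insert j S"
    by blast
  then show "C \<in> ?L"
  proof cases
    case 1
    then show ?thesis by (auto simp: cliques_at_def split_graph_def)
  next
    case (2 j S)
    have "S \<subseteq> K" using 2 N by blast
    moreover from this have "finite S" "j \<notin> S" using 2 fin disj finite_subset by auto
    ultimately show ?thesis
      using 2 by (auto simp: cliques_at_def split_graph_def)
  qed
qed

lemma card_cliques_at_indep:
  assumes j: "j \<in> J"
  shows "card (cliques_at (split_graph K J N) (Suc m) j) = card (N j) choose m"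
proof -
  have "cliques_at (split_graph K J N) (Suc m) j = insert j ` {S. S \<subseteq> N j \<and> card S = m}"
  proof -
    have "j \<notin> K" using j disj by auto
    then have "{C. C \<subseteq> K \<and> card C = Suc m \<and> j \<in> C} = {}"
      and "\<And>i S. i \<in> J \<Longrightarrow> S \<subseteq> N i \<Longrightarrow> j \<notin> S" using N by blast+
    then show ?thesis unfolding cliques_at_split_graph using j by blast
  qed
  moreover have "inj_on (insert j) {S. S \<subseteq> N j \<and> card S = m}"
    by (rule inj_on_insert) (use j disj N[OF j] in auto)
  moreover have "finite (N j)" using N[OF j] fin finite_subset by auto
  ultimately show ?thesis by (simp add: card_image n_subsets)
qed

lemma card_cliques_at_clique:
  assumes u: "u \<in> K"
  shows "card (cliques_at (split_graph K J N) (Suc m) u) =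
    (card K - 1 choose m) + (\<Sum>j\<in>{j \<in> J. u \<in> N j}. card (N j) - 1 choose (m - 1))"
proof -
  let ?A = "\<lambda>j. {S. S \<subseteq> N j \<and> card S = m \<and> u \<in> S}"
  let ?J = "{j \<in> J. u \<in> N j}"
  have eq: "cliques_at (split_graph K J N) (Suc m) u =
      {C. C \<subseteq> K \<and> card C = Suc m \<and> u \<in> C} \<union> (\<Union>j\<in>?J. insert j ` ?A j)"
    unfolding cliques_at_split_graph using u disj by auto
  have finN: "finite (N j)" if "j \<in> J" for j using N[OF that] fin finite_subset by auto
  have "{C. C \<subseteq> K \<and> card C = Suc m \<and> u \<in> C} \<inter> (\<Union>j\<in>?J. insert j ` ?A j) = {}"
    using disj by auto
  moreover have "finite (insert j ` ?A j)" if "j \<in> ?J" for j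
    using that finN[of j] by auto
  moreover have "card (\<Union>j\<in>?J. insert j ` ?A j) = (\<Sum>j\<in>?J. card (insert j ` ?A j))"
  proof (rule card_UN_disjoint)
    show "\<forall>i\<in>?J. \<forall>j\<in>?J. i \<noteq> j \<longrightarrow> insert i ` ?A i \<inter> insert j ` ?A j = {}"
    proof (intro ballI impI)
      fix i j assume ij: "i \<in> ?J" "j \<in> ?J" "i \<noteq> j"
      then have "j \<notin> insert i S" if "S \<in> ?A i" for S
        using that N[of i] disj by auto
      then show "insert i ` ?A i \<inter> insert j ` ?A j = {}" by blast
    qed
  qed (use fin finN in auto)
  moreover have "card (insert j ` ?A j) = card (N j) - 1 choose (m - 1)" if "j \<in> ?J" for j
  proof -
    have "inj_on (insert j) (?A j)"
      by (rule inj_on_insert) (use that disj N[of j] in auto)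
    then show ?thesis
      using that finN[of j] m by (simp add: card_image card_subsets_containing)
  qed
  ultimately show ?thesis
    unfolding eq using fin u card_subsets_containing[of K u "Suc m"]
    by (subst card_Un_disjoint) auto
qed

end

text \<open>Hockey-stick identity; it turns the deficit of a clique vertex below the top into a
  single binomial coefficient.\<close>

lemma sum_binomial_interval:
  assumes "p \<le> t" "0 < p"
  shows "(\<Sum>d = p..<t. (d - 1) choose m) + ((p - 1) choose Suc m) = (t - 1) choose Suc m"
  using assms(1)
proof (induction t rule: dec_induct)
  case (step n)
  have "n = Suc (n - 1)" using step assms by simp
  then have "n choose Suc m = (n - 1 choose m) + (n - 1 choose Suc m)"
    by (metis binomial_Suc_Suc)
  then show ?case using step by simp
qed simp

lemma binomial_strict_mono_left:
  assumes "m \<le> a" "a < b" "0 < m"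
  shows "a choose m < b choose m"
proof -
  obtain m' where m': "m = Suc m'" using assms(3) by (cases m) auto
  have "a choose m < Suc a choose m"
    using assms m' by (simp add: zero_less_binomial_iff)
  also have "\<dots> \<le> b choose m" using assms(2) by (intro binomial_right_mono) simp
  finally show ?thesis .
qed

lemma less_binomial_add: "0 < m \<Longrightarrow> n < (m + n) choose m"
proof (induction n)
  case (Suc n)
  then obtain m' where "m = Suc m'" by (cases m) auto
  then have "(m + Suc n) choose m = ((m + n) choose m') + ((m + n) choose m)" by simp
  moreover have "0 < (m + n) choose m'" using \<open>m = Suc m'\<close> by (simp add: zero_less_binomial_iff)
  ultimately show ?case using Suc by linarith
qed simp

text \<open>For \<open>n < p\<close> the prime divides the left side but not the right side, a
  divisor of \<open>fact n\<close>. For larger \<open>n\<close> the right side is larger, since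
  \<open>2 * Suc m < p\<close> keeps \<open>m\<close> and \<open>Suc m\<close> in the increasing
  half of row \<open>p\<close>.\<close>

lemma prime_binomial_neq:
  assumes "prime (p :: nat)" "2 * Suc m < p" "0 < m"
  shows "p choose m \<noteq> n choose Suc m"
proof
  assume eq: "p choose m = n choose Suc m"
  have dvd: "p dvd p choose m"
    using assms by (intro dvd_choose_prime) auto
  have pos: "0 < p choose m" using assms by (simp add: zero_less_binomial_iff)
  show False
  proof (cases "n < p")
    case True
    have "Suc m \<le> n" using eq pos by (simp add: zero_less_binomial_iff)
    then have "n choose Suc m dvd fact n"
      using binomial_fact_lemma[of "Suc m" n] by (metis dvd_triv_right)
    then have "p dvd fact n" using dvd eq by (metis dvd_trans)
    then show False using True assms(1) by (simp add: prime_dvd_fact_iff)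
  next
    case False
    have "p choose m < p choose Suc m" using assms by (intro binomial_strict_mono) auto
    also have "\<dots> \<le> n choose Suc m" using False by (intro binomial_right_mono) simp
    finally show False using eq by simp
  qed
qed

lemma ex_irregular_of_complete:
  assumes F: "pair_graph F" and V: "card (pverts F) \<ge> 3"
    and complete: "\<And>x y. x \<in> pverts F \<Longrightarrow> y \<in> pverts F \<Longrightarrow> x \<noteq> y \<Longrightarrow> (x, y) \<in> parcs F"
  shows "\<exists>G :: nat pair_pre_digraph. pair_graph G \<and> F_irregular F G \<and> n \<le> card (pverts G)"
proof -
  define \<delta> where "\<delta> = card (pverts F) - 1"
  define l where "l = \<delta> - 1"
  have \<delta>: "2 \<le> \<delta>" "\<delta> = Suc l" "0 < l" "card (pverts F) = Suc \<delta>"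
    using V by (auto simp: \<delta>_def l_def)
  define S where "S = {p. prime p \<and> 2 * \<delta> < (p :: nat)}"
  have "infinite S"
  proof
    assume "finite S"
    then have "finite (S \<union> {..2 * \<delta>})" by simp
    moreover have "{p :: nat. prime p} \<subseteq> S \<union> {..2 * \<delta>}" by (auto simp: S_def)
    ultimately show False using primes_infinite finite_subset by blast
  qed
  \<comment> \<open>The set of size \<open>P q + 1\<close> contains \<open>t\<close> in place of \<open>q\<close>.\<close>
  define P where "P = enumerate S"
  have P: "prime (P q)" "2 * \<delta> < P q" for q
    using enumerate_in_set[OF \<open>infinite S\<close>] by (auto simp: P_def S_def)
  have P_less: "P q < P r" if "q < r" for q r
    unfolding P_def by (rule enumerate_mono[OF that \<open>infinite S\<close>])
  then have P_inj: "P q = P r \<longleftrightarrow> q = r" for q r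
    by (metis linorder_neq_iff less_irrefl)
  \<comment> \<open>One of the \<delta> top vertices can stay in all the sets; only the others need
    to be moved.\<close>
  define Q where "Q = {1..<\<delta>}"
  define \<sigma> where "\<sigma> = (\<Sum>q\<in>Q. P q choose l)"
  \<comment> \<open>The summand \<sigma> makes the coefficients in row \<open>t - 2\<close> exceed
    \<sigma>, the sum of the primes puts all modified sizes below \<open>t\<close>, and
    \<open>n\<close> forces the order.\<close>
  define t where "t = \<delta> + \<sigma> + (\<Sum>q\<in>Q. P q) + n + 4"
  have finQ: "finite Q" by (simp add: Q_def)
  have P_t: "P q + 1 < t" if "q \<in> Q" for q
    using member_le_sum[OF that, of P] finQ by (simp add: t_def)
  have P_\<sigma>: "P q choose l \<le> \<sigma>" if "q \<in> Q" for q
    unfolding \<sigma>_def using member_le_sum[OF that, of "\<lambda>q. P q choose l"] finQ by simp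
  define K where "K = {1..t}"
  define J where "J = {t + \<delta>..<2 * t}"
  \<comment> \<open>Trading \<open>q\<close> for \<open>t\<close> preserves the size, hence the
    degree of the independent vertex. A member of a set of size \<open>d\<close> lies in
    \<open>(d - 1) choose l\<close> of its \<delta>-subsets, so the size \<open>P q + 1\<close>
    makes the loss of \<open>q\<close> equal to \<open>P q choose l\<close>.\<close>
  define N where "N w = {p \<in> {1..w - t}. \<not> (p < \<delta> \<and> w - t = P p + 1)} \<union>
      {p. p = t \<and> (\<exists>q\<in>Q. w - t = P q + 1)}" for w
  define G where "G = split_graph K J N"
  have N_K: "N j \<subseteq> K" if "j \<in> J" for j
    using that by (auto simp: N_def J_def K_def)
  have disj: "K \<inter> J = {}" using \<delta> by (auto simp: K_def J_def)
  have fin: "finite K" "finite J" by (auto simp: K_def J_def)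
  have G: "pair_graph G"
    unfolding G_def by (rule pair_graph_split_graph) (use fin N_K in auto)
  have F_deg: "F_degree F G u = card (cliques_at (split_graph K J N) (Suc \<delta>) u)" for u
    using F_degree_complete[OF F G complete, of u] by (simp add: \<delta>(4) flip: G_def)
  have card_N: "card (N (t + d)) = d" if d: "d \<in> {\<delta>..<t}" for d
  proof (cases "\<exists>q\<in>Q. d = P q + 1")
    case True
    then obtain q where q: "q \<in> Q" "d = P q + 1" by blast
    have "N (t + d) = insert t ({1..d} - {q})"
      using q by (auto simp: N_def Q_def P_inj)
    moreover have "q \<in> {1..d}" "t \<notin> {1..d} - {q}" using q d by (auto simp: Q_def)
    moreover have "0 < d" using d \<delta> by simp
    ultimately show ?thesis by (simp del: atLeastAtMost_iff)
  next
    case False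
    then have "N (t + d) = {1..d}" by (auto simp: N_def Q_def)
    then show ?thesis by simp
  qed
  define e where "e p = (\<Sum>d\<in>{d \<in> {\<delta>..<t}. p \<in> N (t + d)}. (d - 1) choose l)" for p
  define E where "E = (t - 1) choose \<delta>"
  have deg_K: "F_degree F G p = E + e p" if p: "p \<in> K" for p
  proof -
    have J_eq: "{j \<in> J. p \<in> N j} = (+) t ` {d \<in> {\<delta>..<t}. p \<in> N (t + d)}"
    proof (intro equalityI subsetI)
      fix w assume "w \<in> {j \<in> J. p \<in> N j}"
      then have "w = t + (w - t)" "w - t \<in> {d \<in> {\<delta>..<t}. p \<in> N (t + d)}" by (auto simp: J_def)
      then show "w \<in> (+) t ` {d \<in> {\<delta>..<t}. p \<in> N (t + d)}" by (rule image_eqI)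
    qed (auto simp: J_def)
    have "F_degree F G p = (card K - 1 choose \<delta>) + (\<Sum>j\<in>{j \<in> J. p \<in> N j}. card (N j) - 1 choose (\<delta> - 1))"
      unfolding F_deg
      by (rule card_cliques_at_clique) (use fin disj N_K p \<delta> in auto)
    also have "(\<Sum>j\<in>{j \<in> J. p \<in> N j}. card (N j) - 1 choose (\<delta> - 1)) = e p"
      unfolding e_def J_eq by (subst sum.reindex) (auto simp: card_N \<delta>(2))
    finally show ?thesis by (simp add: E_def K_def)
  qed
  have deg_J: "F_degree F G (t + d) = d choose \<delta>" if d: "d \<in> {\<delta>..<t}" for d
  proof -
    have "F_degree F G (t + d) = card (N (t + d)) choose \<delta>"
      unfolding F_deg
      by (rule card_cliques_at_indep) (use fin disj N_K d \<delta> in \<open>auto simp: J_def\<close>)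
    then show ?thesis using card_N[OF d] by simp
  qed
  \<comment> \<open>\<open>x p\<close> is the deficit of the vertex \<open>p\<close> against the vertex \<open>\<delta>\<close>, which lies in all the sets.\<close>
  define x where "x p = (if p < \<delta> then P p choose l else (p - 1) choose \<delta>)" for p
  have e_x: "e p + x p = E" if p: "p \<in> {1..<t}" for p
  proof (cases "p < \<delta>")
    case False
    then have "{d \<in> {\<delta>..<t}. p \<in> N (t + d)} = {p..<t}"
      using p by (auto simp: N_def)
    then show ?thesis
      using False p sum_binomial_interval[of p t l] by (simp add: e_def x_def E_def \<delta>(2))
  next
    case True
    have pQ: "p \<in> Q" using True p by (simp add: Q_def)
    have "{d \<in> {\<delta>..<t}. p \<in> N (t + d)} = {\<delta>..<t} - {P p + 1}"
      using True p by (auto simp: N_def)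
    moreover have "P p + 1 \<in> {\<delta>..<t}" using P(2)[of p] P_t[OF pQ] by simp
    ultimately have "e p + x p = (\<Sum>d = \<delta>..<t. (d - 1) choose l)"
      using True by (simp add: e_def x_def sum.remove[of _ "P p + 1"])
    also have "\<dots> = E"
      using sum_binomial_interval[of \<delta> t l] by (simp add: E_def \<delta>(2) t_def binomial_eq_0)
    finally show ?thesis .
  qed
  have e_t: "e t = \<sigma>"
  proof -
    have "{d \<in> {\<delta>..<t}. t \<in> N (t + d)} = (\<lambda>q. P q + 1) ` Q"
    proof -
      have "P q + 1 \<in> {\<delta>..<t}" if "q \<in> Q" for q using P(2)[of q] P_t[OF that] by simp
      then show ?thesis by (auto simp: N_def)
    qed
    moreover have "inj_on (\<lambda>q. P q + 1) Q" by (simp add: inj_on_def P_inj)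
    ultimately show ?thesis by (simp add: e_def \<sigma>_def sum.reindex)
  qed
  have \<sigma>_less: "\<sigma> < (t - 2) choose l" "\<sigma> < (t - 2) choose \<delta>"
  proof -
    have "\<sigma> < (m + \<sigma>) choose m" "(m + \<sigma>) choose m \<le> (t - 2) choose m" if "0 < m" "m \<le> \<delta>" for m
      using that by (auto intro!: less_binomial_add binomial_right_mono simp: t_def)
    from this[of l] this[of \<delta>] show "\<sigma> < (t - 2) choose l" "\<sigma> < (t - 2) choose \<delta>"
      using \<delta> by auto
  qed
  have E_eq: "E = ((t - 2) choose l) + ((t - 2) choose \<delta>)"
  proof -
    have "t - 1 = Suc (t - 2)" by (simp add: t_def)
    then show ?thesis by (simp add: E_def \<delta>(2))
  qed
  \<comment> \<open>The deficit \<open>x p\<close> is at most \<sigma> or at most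
    \<open>(t - 2) choose \<delta>\<close>, and \<open>E\<close> exceeds either bound by more than
    \<sigma>.\<close>
  have e_gt: "\<sigma> < e p" if p: "p \<in> {1..<t}" for p
  proof (cases "p < \<delta>")
    case True
    then have "x p \<le> \<sigma>" using p P_\<sigma>[of p] by (simp add: x_def Q_def)
    then show ?thesis using e_x[OF p] E_eq \<sigma>_less by linarith
  next
    case False
    moreover have "p - 1 \<le> t - 2" using p by auto
    ultimately have "x p \<le> (t - 2) choose \<delta>"
      by (simp add: x_def binomial_right_mono)
    then show ?thesis using e_x[OF p] E_eq \<sigma>_less by linarith
  qed
  have \<sigma>_pos: "0 < \<sigma>"
  proof -
    have "1 \<in> Q" using \<delta> by (simp add: Q_def)
    moreover have "0 < P 1 choose l" using P(2)[of 1] \<delta> by (simp add: zero_less_binomial_iff)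
    ultimately show ?thesis using P_\<sigma>[of 1] by linarith
  qed
  have x_less: "x p \<noteq> x r" if "p \<in> {1..<t}" "r \<in> {1..<t}" "p < r" for p r
  proof -
    consider "r < \<delta>" | "p < \<delta>" "\<delta> \<le> r" | "\<delta> \<le> p" by linarith
    then show ?thesis
    proof cases
      case 1
      then show ?thesis
        using that P_less[of p r] P(2)[of p] \<delta> binomial_strict_mono_left[of l "P p" "P r"]
        by (simp add: x_def)
    next
      case 2
      \<comment> \<open>A traded top vertex against a vertex outside \<open>Q\<close>: the one place
        where primality enters.\<close>
      then show ?thesis
        using prime_binomial_neq[OF P(1), of l p "r - 1"] P(2)[of p] \<delta> by (simp add: x_def)
    next
      case 3
      have "x p < x r"
      proof (cases "p = \<delta>")
        case True
        then show ?thesis using that 3 \<delta>(2) by (simp add: x_def zero_less_binomial_iff binomial_eq_0)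
      next
        case False
        then show ?thesis
          using that 3 \<delta> binomial_strict_mono_left[of \<delta> "p - 1" "r - 1"] by (simp add: x_def)
      qed
      then show ?thesis by simp
    qed
  qed
  have "inj_on (F_degree F G) (K \<union> J)"
  proof (rule linorder_inj_onI)
    fix p r assume pr: "p < r" "p \<in> K \<union> J" "r \<in> K \<union> J"
    have J: "\<exists>d\<in>{\<delta>..<t}. w = t + d" if "w \<in> J" for w
      using that by (intro bexI[of _ "w - t"]) (auto simp: J_def)
    have pos: "0 < e w" if "w \<in> K" for w
      using that e_gt[of w] e_t \<sigma>_pos by (cases "w = t") (auto simp: K_def)
    consider "r \<in> K" "p \<in> K" | "p \<in> K" "r \<in> J" | "p \<in> J" "r \<in> J"
      using pr by (auto simp: K_def J_def)
    then show "F_degree F G p \<noteq> F_degree F G r"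
    proof cases
      case 1
      have p: "p \<in> {1..<t}" using 1 pr by (auto simp: K_def)
      have "e p \<noteq> e r"
      proof (cases "r = t")
        case True
        then show ?thesis using e_gt[OF p] e_t by simp
      next
        case False
        then have r: "r \<in> {1..<t}" using 1 pr by (auto simp: K_def)
        then show ?thesis using e_x[OF p] e_x[OF r] x_less[OF p r pr(1)] by linarith
      qed
      then show ?thesis using 1 by (simp add: deg_K)
    next
      case 2
      obtain d where d: "d \<in> {\<delta>..<t}" "r = t + d" using J 2 by blast
      \<comment> \<open>Independent vertices have degree at most \<open>E\<close>, clique vertices
        strictly more.\<close>
      have "d choose \<delta> \<le> E" unfolding E_def using d by (intro binomial_right_mono) auto
      then show ?thesis using deg_J[OF d(1)] deg_K[of p] pos[of p] 2 d by simp
    next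
      case 3
      obtain d d' where d: "d \<in> {\<delta>..<t}" "p = t + d" "d' \<in> {\<delta>..<t}" "r = t + d'"
        using J 3 by blast
      have "d choose \<delta> < d' choose \<delta>"
        using d pr(1) \<delta> by (intro binomial_strict_mono_left) auto
      then show ?thesis using deg_J[OF d(1)] deg_J[OF d(3)] d by simp
    qed
  qed auto
  then have "F_irregular F G" by (simp add: F_irregular_def G_def split_graph_def)
  moreover have "n \<le> card (pverts G)"
  proof -
    have "card K \<le> card (K \<union> J)" using fin by (intro card_mono) auto
    then show ?thesis by (simp add: G_def split_graph_def K_def t_def)
  qed
  ultimately show ?thesis using G by blast
qed

section \<open>Incomplete patterns: the host graph\<close>

text \<open>
  The clique vertices are \<open>1..t\<close>. The independent vertices are \<open>t + d\<close>, joined to \<open>{1..d}\<close>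
  (\<open>chain\<close>), and \<open>e i = 2 * t + i\<close> for \<open>1 \<le> i \<le> \<delta> + 1\<close> (\<open>extra\<close>). The set \<open>N (e i)\<close> loses the top
  vertices \<open>1..i - 1\<close> and is filled up to \<open>\<delta>\<close> elements with \<open>y 1, ..., y (i - 1)\<close>. As \<open>y \<delta> = t\<close>,
  this also separates the bottom vertices \<open>t - 1\<close> and \<open>t\<close>. The parameter \<open>M\<close> counts the choices for
  each free vertex; it exceeds every constant depending on \<open>F\<close> only.
  In increasing order of degree: \<open>e (\<delta> + 1), ..., e 1\<close>, then \<open>t + \<delta> + 1, ..., 2 * t - 2\<close>, then
  \<open>t - 1, t, t - 2, t - 3, ..., \<delta> + 1\<close>, then \<open>1, ..., \<delta>\<close>.
\<close>

locale sparse_construction =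
  fixes F :: "'a pair_pre_digraph" and v x u x\<^sub>0 x\<^sub>1 :: 'a and \<iota> :: "'a \<Rightarrow> nat" and \<delta> k M :: nat
  assumes F_graph: "pair_graph F" and v_vert: "v \<in> pverts F"
    and card_nbs_v: "card (nbs F v) = \<delta>"
    and min_deg: "\<And>w. w \<in> pverts F \<Longrightarrow> \<delta> \<le> card (nbs F w)"
    and x: "x \<in> nbs F v" and u: "u \<in> nbs F x" "u \<noteq> v" "u \<notin> nbs F v"
    and x\<^sub>1: "x\<^sub>1 \<in> nbs F x\<^sub>0" and deg_x\<^sub>0: "2 \<le> card (nbs F x\<^sub>0)"
    and card_F: "card (pverts F) = k" and \<iota>: "bij_betw \<iota> (pverts F) {1..k}"
    and M: "k ^ (k + 1) * (8 * k) ^ k < M"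
begin

text \<open>Spacing of the reservoirs of \<open>M\<close> vertices. The spare positions keep the
  slots just below \<open>y \<delta> = t\<close> inside the chain, whose last index is
  \<open>t - 2\<close>.\<close>

definition "L = M + 2"
text \<open>Multiples of \<open>L\<close> up to \<open>k * L\<close> start the blocks of the pattern
  vertices. Hence chain vertices \<open>t + d\<close> with \<open>d \<ge> (k + 1) * L\<close> are
  joined to all blocks.\<close>

definition "y j = (k + 1 + j) * L"
definition "t = y \<delta>"
definition "K = {1..t}"
definition "chain = {t + \<delta> + 1..2 * t - 2}"
definition "e i = 2 * t + i"
definition "extra = {e 1..e (\<delta> + 1)}"
definition "N w = (if w \<le> 2 * t then {1..w - t} else {w - 2 * t..\<delta>} \<union> y ` {1..<w - 2 * t})"
definition "J = chain \<union> extra"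

lemma arc_F: "(a, b) \<in> parcs F \<Longrightarrow> a \<in> pverts F \<and> b \<in> pverts F \<and> (b, a) \<in> parcs F \<and> a \<noteq> b"
  using F_graph by (auto simp: pair_graph_iff)

lemma finite_F: "finite (pverts F)"
  using F_graph by (auto simp: pair_graph_iff)

lemma nbs_F: "nbs F w \<subseteq> pverts F - {w}"
  using arc_F by (auto simp: nbs_def)

lemma finite_nbs: "finite (nbs F w)"
  using nbs_F finite_F by (meson finite_Diff finite_subset)

lemma \<delta>_pos: "1 \<le> \<delta>"
  using x finite_nbs[of v] card_nbs_v by (metis One_nat_def Suc_leI card_gt_0_iff empty_iff)

lemma \<delta>_k: "\<delta> + 2 \<le> k"
proof -
  have "card (insert u (insert v (nbs F v))) = \<delta> + 2"
    using u(2,3) nbs_F[of v] finite_nbs[of v] card_nbs_v by (subst card_insert_disjoint; force)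
  moreover have "insert u (insert v (nbs F v)) \<subseteq> pverts F"
    using u(1) v_vert nbs_F by blast
  ultimately show ?thesis using card_mono[OF finite_F] card_F by metis
qed

lemma k_less_M: "k < M"
proof -
  have "k \<le> k ^ (k + 1)" using \<delta>_k by (simp add: self_le_power)
  also have "\<dots> \<le> k ^ (k + 1) * (8 * k) ^ k" using \<delta>_k by simp
  finally show ?thesis using M by linarith
qed

lemma L_bounds: "k + 2 < L" "L \<le> 2 * M" "3 \<le> L" "M < L"
  using k_less_M \<delta>_k by (auto simp: L_def)

lemma y_mono: "i < j \<Longrightarrow> y i < y j"
  using L_bounds by (simp add: y_def)

lemma y_eq_iff [simp]: "y i = y j \<longleftrightarrow> i = j"
  using L_bounds by (simp add: y_def)

lemma y_ge: "(k + 1) * L \<le> y j" "L \<le> y j"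
  by (auto simp: y_def)

lemma \<delta>_less_y: "\<delta> < y j"
  using y_ge(2)[of j] L_bounds \<delta>_k by linarith

lemma y_le_t: "j \<le> \<delta> \<Longrightarrow> y j \<le> t"
  by (simp add: t_def y_def)

lemma t_bounds: "\<delta> + 4 \<le> t" "k < t" "t \<le> 4 * k * M"
proof -
  show "k < t" using y_ge(2)[of \<delta>] L_bounds by (simp add: t_def)
  show "\<delta> + 4 \<le> t" using y_ge(2)[of \<delta>] L_bounds \<delta>_k by (simp add: t_def)
  have "t \<le> 2 * k * L" unfolding t_def y_def using \<delta>_k by (intro mult_right_mono) auto
  also have "\<dots> \<le> 2 * k * (2 * M)" using L_bounds by simp
  finally show "t \<le> 4 * k * M" by simp
qed

lemma chain_iff: "w \<in> chain \<longleftrightarrow> (\<exists>d. w = t + d \<and> \<delta> + 1 \<le> d \<and> d \<le> t - 2)"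
  using t_bounds by (auto simp: chain_def intro!: exI[of _ "w - t"])

lemma extra_iff: "w \<in> extra \<longleftrightarrow> (\<exists>i. w = e i \<and> 1 \<le> i \<and> i \<le> \<delta> + 1)"
  by (auto simp: extra_def e_def intro!: exI[of _ "w - 2 * t"])

lemma e_eq_iff [simp]: "e i = e j \<longleftrightarrow> i = j"
  by (simp add: e_def)

lemma N_chain: "d \<le> t \<Longrightarrow> N (t + d) = {1..d}"
  by (simp add: N_def)

lemma N_extra: "1 \<le> i \<Longrightarrow> N (e i) = {i..\<delta>} \<union> y ` {1..<i}"
  by (simp add: N_def e_def)

lemma card_N_extra:
  assumes "1 \<le> i" "i \<le> \<delta> + 1"
  shows "card (N (e i)) = \<delta>"
proof -
  have "y j \<notin> {i..\<delta>}" for j using \<delta>_less_y[of j] by simp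
  then have "{i..\<delta>} \<inter> y ` {1..<i} = {}" by blast
  moreover have "inj_on y {1..<i}" by (simp add: inj_on_def)
  ultimately show ?thesis
    using assms by (simp add: N_extra card_Un_disjoint card_image)
qed

lemma J_cases:
  assumes "j \<in> J"
  obtains d where "j = t + d" "\<delta> + 1 \<le> d" "d \<le> t - 2" | i where "j = e i" "1 \<le> i" "i \<le> \<delta> + 1"
  using assms unfolding J_def chain_iff extra_iff Un_iff by blast

lemma N_subset_K:
  assumes "j \<in> J"
  shows "N j \<subseteq> K"
  using assms
  proof (cases rule: J_cases)
    case (1 d)
    then have "N j = {1..d}" "d \<le> t" by (simp_all add: N_chain)
    then show ?thesis by (auto simp: K_def)
  next
    case (2 i)
    have "y a \<in> K" if "a < i" for a
      using y_le_t[of a] y_ge(2)[of a] L_bounds that 2(3) by (simp add: K_def)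
    moreover have "{i..\<delta>} \<subseteq> K" using 2(2) t_bounds(1) by (auto simp: K_def)
    ultimately show ?thesis unfolding 2(1) N_extra[OF 2(2)] by auto
  qed

lemma \<delta>_le_card_N:
  assumes "j \<in> J"
  shows "\<delta> \<le> card (N j)"
  using assms
proof (cases rule: J_cases)
  case (1 d)
  then have "N j = {1..d}" by (simp add: N_chain)
  then show ?thesis using 1 by simp
next
  case 2
  then show ?thesis using card_N_extra by simp
qed

sublocale split_host F K J N v
proof (rule split_host.intro)
  show "pair_graph F" by (rule F_graph)
  show "v \<in> pverts F" by (rule v_vert)
  show "nbs F v \<noteq> {}" using x by blast
  show "finite K" "finite J" by (simp_all add: K_def J_def chain_def extra_def)
  show "K \<inter> J = {}"
    using t_bounds by (auto simp: K_def J_def chain_def extra_def e_def)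
  show "card (nbs F v) \<le> card (N j)" if "j \<in> J" for j
    using \<delta>_le_card_N[OF that] card_nbs_v by simp
  show "N j \<subseteq> K" if "j \<in> J" for j by (rule N_subset_K[OF that])
  show "card (pverts F) \<le> card K" using card_F t_bounds by (simp add: K_def)
qed

section \<open>Counting embeddings at the scale \<open>M\<close>\<close>

lemma card_H: "card (pverts H) \<le> 8 * k * M"
proof -
  have "card (pverts H) \<le> card {1..2 * t + \<delta> + 1 - (\<delta> + 1)}"
  proof -
    have "card (K \<union> J) \<le> card K + (card chain + card extra)"
      unfolding J_def by (meson card_Un_le le_trans add_left_mono)
    also have "\<dots> \<le> t + ((t - 2 - \<delta>) + (\<delta> + 1))"
      using t_bounds by (simp add: K_def chain_def extra_def e_def)
    finally show ?thesis using t_bounds by simp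
  qed
  then show ?thesis using t_bounds(3) by simp
qed

text \<open>This is the origin of the lower bound on \<open>M\<close>: the order is at most
  \<open>8 * k * M\<close>, and the factor \<open>k ^ (k + 1)\<close> allows for \<open>k\<close>
  families with \<open>k ^ k\<close> choices of preimages each.\<close>

lemma sparse_power_bound:
  assumes "s \<le> k"
  shows "k ^ (k + 1) * card (pverts H) ^ s < M ^ Suc s"
proof -
  have "k ^ (k + 1) * card (pverts H) ^ s \<le> k ^ (k + 1) * (8 * k * M) ^ s"
    using card_H by (intro mult_left_mono power_mono) auto
  also have "\<dots> = (k ^ (k + 1) * (8 * k) ^ s) * M ^ s"
    by (simp add: power_mult_distrib)
  also have "\<dots> \<le> (k ^ (k + 1) * (8 * k) ^ k) * M ^ s"
    using assms \<delta>_k by (intro mult_right_mono mult_left_mono power_increasing) auto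
  also have "\<dots> < M * M ^ s"
    using M k_less_M by (intro mult_strict_right_mono) auto
  finally show ?thesis by simp
qed

text \<open>Covering a prescribed set of \<open>k - s\<close> vertices leaves only \<open>s\<close>
  pattern vertices free, one less than in the families of size \<open>M ^ Suc s\<close>.\<close>

lemma card_covering_family_less:
  assumes "X \<subseteq> (\<Union>z\<in>Z. {f \<in> embs F H. S z \<subseteq> f ` pverts F})"
    and "finite Z" "card Z \<le> k" "\<And>z. z \<in> Z \<Longrightarrow> finite (S z) \<and> card (S z) = k - s"
    and "s \<le> k"
  shows "card X < M ^ Suc s"
proof -
  let ?C = "\<lambda>z. {f \<in> embs F H. S z \<subseteq> f ` pverts F}"
  have "card (?C z) \<le> k ^ k * card (pverts H) ^ s" if "z \<in> Z" for z
  proof -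
    have "K \<noteq> {}" using t_bounds by (simp add: K_def)
    then have "1 \<le> card (pverts H)"
      using card_gt_0_iff[of "pverts H"] fin by (simp add: Suc_le_eq)
    have "card (?C z) \<le> k ^ (k - s) * card (pverts H) ^ (k - (k - s))"
      using card_embs_covering_le[OF F H, of "S z"] assms(4)[OF that] card_F by simp
    also have "\<dots> \<le> k ^ k * card (pverts H) ^ s"
      using \<delta>_k assms(5) \<open>1 \<le> card (pverts H)\<close> by (intro mult_mono power_increasing) auto
    finally show ?thesis .
  qed
  then have "card (\<Union>z\<in>Z. ?C z) \<le> (\<Sum>z\<in>Z. k ^ k * card (pverts H) ^ s)"
    using card_UN_le[OF assms(2), of ?C] sum_mono[of Z "\<lambda>z. card (?C z)"] by (meson le_trans)
  also have "\<dots> \<le> k * (k ^ k * card (pverts H) ^ s)"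
    using assms(3) by simp
  also have "\<dots> < M ^ Suc s" using sparse_power_bound[OF assms(5)] by simp
  finally have "card (\<Union>z\<in>Z. ?C z) < M ^ Suc s" .
  moreover have "finite (\<Union>z\<in>Z. ?C z)" using finite_embs[OF F H] assms(2) by simp
  ultimately show ?thesis using card_mono[OF _ assms(1)] by (meson le_less_trans)
qed

text \<open>The pattern vertex at \<open>e i\<close> has at least \<delta> neighbours, and only
  \<delta> places are available for them.\<close>

lemma N_extra_covered:
  assumes f: "f \<in> embs F H" and i: "1 \<le> i" "i \<le> \<delta> + 1" and im: "e i \<in> f ` pverts F"
  shows "N (e i) \<subseteq> f ` pverts F"
proof -
  obtain z where z: "z \<in> pverts F" "f z = e i" using im by auto
  have J: "e i \<in> J" using i by (auto simp: J_def extra_iff)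
  have sub: "f ` nbs F z \<subseteq> N (e i)"
    using f J unfolding embs_H_iff z(2)[symmetric] by (auto simp: nbs_def)
  have "inj_on f (nbs F z)"
    using embsD(2)[OF f] nbs_F[of z] by (meson Diff_subset inj_on_subset)
  then have "\<delta> \<le> card (f ` nbs F z)"
    using min_deg[OF z(1)] by (simp add: card_image)
  moreover have "finite (N (e i))" using i by (simp add: N_extra)
  ultimately have "f ` nbs F z = N (e i)"
    using sub card_N_extra[OF i] by (metis card_seteq)
  then show ?thesis using nbs_F[of z] by blast
qed

text \<open>Disjoint reservoirs, one for each pattern vertex, so that independent choices stay
  injective.\<close>

definition "block w = {\<iota> w * L..<\<iota> w * L + M}"

lemma block_bounds:
  assumes "w \<in> pverts F" "a \<in> block w"
  shows "\<delta> < a" "a < (k + 1) * L" "a \<in> K"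
proof -
  have w: "1 \<le> \<iota> w" "\<iota> w \<le> k" using \<iota> assms(1) by (auto simp: bij_betw_def)
  have "1 * L \<le> \<iota> w * L" "\<iota> w * L \<le> k * L" using w by (intro mult_right_mono; simp)+
  moreover have "\<iota> w * L \<le> a" "a < \<iota> w * L + M" using assms(2) by (auto simp: block_def)
  moreover have "(k + 1) * L = k * L + L" by simp
  ultimately show "\<delta> < a" and a: "a < (k + 1) * L"
    using L_bounds \<delta>_k by linarith+
  then show "a \<in> K" using y_ge(1)[of \<delta>] by (simp add: K_def t_def)
qed

lemma block_disjoint:
  assumes "w \<in> pverts F" "w' \<in> pverts F" "a \<in> block w" "a \<in> block w'"
  shows "w = w'"
proof -
  have "a div L = \<iota> z" if "a \<in> block z" for z
    using that L_bounds by (intro div_nat_eqI) (auto simp: block_def algebra_simps)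
  then have "\<iota> w = \<iota> w'" using assms by metis
  then show ?thesis using \<iota> assms(1,2) by (auto simp: bij_betw_def dest: inj_onD)
qed

end

section \<open>Incomplete patterns: breaking the ties\<close>

lemma embs_atI: "f \<in> embs F G \<Longrightarrow> z \<in> pverts F \<Longrightarrow> f z = a \<Longrightarrow> f \<in> embs_at F G a"
  unfolding embs_at_def by blast

lemma disjoint_imageI: "(\<And>a. a \<in> A \<Longrightarrow> \<phi> a \<notin> T) \<Longrightarrow> T \<inter> \<phi> ` A = {}"
  by blast

lemma inj_on_Un_disjoint_image:
  "inj_on f A \<Longrightarrow> inj_on f B \<Longrightarrow> f ` A \<inter> f ` B = {} \<Longrightarrow> inj_on f (A \<union> B)"
  unfolding inj_on_Un by blast

lemma (in split_host) compose_in_embs_H: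
  assumes f: "f \<in> embs F H" and inj: "inj_on \<pi> W" "f ` pverts F \<subseteq> W"
    and K: "\<And>a. a \<in> K \<Longrightarrow> a \<in> f ` pverts F \<Longrightarrow> \<pi> a \<in> K"
    and J: "\<And>j. j \<in> J \<Longrightarrow> j \<in> f ` pverts F \<Longrightarrow> \<pi> j \<in> J"
    and N: "\<And>j a. j \<in> J \<Longrightarrow> j \<in> f ` pverts F \<Longrightarrow> a \<in> N j \<Longrightarrow> a \<in> f ` pverts F \<Longrightarrow> \<pi> a \<in> N (\<pi> j)"
  shows "compose (pverts F) \<pi> f \<in> embs F H"
  unfolding embs_H_iff
proof (intro conjI allI impI)
  have f': "f \<in> pverts F \<rightarrow>\<^sub>E K \<union> J" "inj_on f (pverts F)"
    "\<And>x y. (x, y) \<in> parcs F \<Longrightarrow> f x \<in> J \<Longrightarrow> f y \<in> N (f x)"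
    using f by (auto simp: embs_H_iff)
  have KJ: "f z \<in> K \<or> f z \<in> J" if "z \<in> pverts F" for z
    using f'(1) that by auto
  then show "compose (pverts F) \<pi> f \<in> pverts F \<rightarrow>\<^sub>E K \<union> J"
    using K J by (fastforce simp: compose_def)
  show "inj_on (compose (pverts F) \<pi> f) (pverts F)"
    using comp_inj_on[OF f'(2) inj_on_subset[OF inj]] by (simp add: compose_def inj_on_def)
  fix a b assume ab: "(a, b) \<in> parcs F" "compose (pverts F) \<pi> f a \<in> J"
  then have V: "a \<in> pverts F" "b \<in> pverts F" using F_arc by auto
  then have "f a \<in> J" using ab(2) K[of "f a"] KJ[of a] disj by (auto simp: compose_def)
  then show "compose (pverts F) \<pi> f b \<in> N (compose (pverts F) \<pi> f a)"
    using N[of "f a" "f b"] f'(3)[OF ab(1)] V by (simp add: compose_def)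
qed

context sparse_construction
begin

lemma inj_on_block_choice:
  assumes "W \<subseteq> pverts F" "\<And>w. w \<in> W \<Longrightarrow> c w \<in> block w"
  shows "inj_on c W"
proof (rule inj_onI)
  fix a b assume ab: "a \<in> W" "b \<in> W" "c a = c b"
  then have "c a \<in> block a" "c a \<in> block b" using assms(2)[of a] assms(2)[of b] by auto
  then show "a = b" using ab assms(1) block_disjoint by blast
qed

lemma K_J_exclusive: "a \<in> K \<Longrightarrow> a \<notin> J" "a \<in> J \<Longrightarrow> a \<notin> K"
  using disj by auto

lemma e_in_J: "1 \<le> i \<Longrightarrow> i \<le> \<delta> + 1 \<Longrightarrow> e i \<in> J"
  by (auto simp: J_def extra_iff)

lemma chain_in_J: "\<delta> + 1 \<le> d \<Longrightarrow> d \<le> t - 2 \<Longrightarrow> t + d \<in> J"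
  by (auto simp: J_def chain_iff)

lemma chain_neq_e: "d \<le> t - 2 \<Longrightarrow> t + d \<noteq> e i"
  using t_bounds by (simp add: e_def)

text \<open>For \<open>1 \<le> i \<le> \<delta>\<close> these are chain vertices
  \<open>t + d\<close> with \<open>y (i - 1) \<le> d < y i\<close>: joined to all blocks and all of
  \<open>N (e i)\<close>, but not to \<open>y i\<close>.\<close>

definition "arc_slots i = {t + (k + i) * L..<t + (k + i) * L + M}"

lemma arc_slotsD:
  assumes "a \<in> arc_slots i" "1 \<le> i" "i \<le> \<delta>"
  obtains d where "a = t + d" "(k + 1) * L \<le> d" "d < y i" "\<delta> + 1 \<le> d" "d \<le> t - 2"
    "\<And>j. j < i \<Longrightarrow> y j \<le> d"
proof -
  define d where "d = a - t"
  have a: "a = t + d" "(k + i) * L \<le> d" "d < (k + i) * L + M"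
    using assms(1) by (auto simp: arc_slots_def d_def)
  have le: "(k + 1) * L \<le> (k + i) * L" using assms(2) by (intro mult_right_mono) auto
  moreover have yi: "y i = (k + i) * L + L" by (simp add: y_def algebra_simps)
  moreover have "y i \<le> t" using y_le_t[OF assms(3)] .
  moreover have "L \<le> (k + 1) * L" by simp
  moreover have "y j \<le> d" if "j < i" for j
  proof -
    have "y j \<le> (k + i) * L" unfolding y_def using that by (intro mult_right_mono) auto
    then show ?thesis using a by linarith
  qed
  ultimately show ?thesis
    using a L_bounds \<delta>_k L_def by (intro that[of d]) linarith+
qed

text \<open>Fixed are \<open>v\<close> and its \<delta> neighbours. The others range over their
  blocks, except \<open>u\<close>, which ranges over \<open>arc_slots i\<close>; it may sit at an
  independent vertex because it is not adjacent to \<open>v\<close>.\<close>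

lemma card_extra_choices:
  assumes i: "1 \<le> i" "i \<le> \<delta>"
  shows "M ^ (k - \<delta> - 1) \<le>
    card {f \<in> embs F H. f v = e i \<and> f x = i \<and> f u \<in> arc_slots i}" (is "_ \<le> card ?T")
proof -
  let ?V = "pverts F"
  have i': "i \<le> \<delta> + 1" using i by simp
  have "i \<in> N (e i)" using i by (simp add: N_extra)
  moreover have "finite (N (e i))" using i by (simp add: N_extra)
  ultimately have "\<exists>b. inj_on b (nbs F v) \<and> b ` nbs F v \<subseteq> N (e i) \<and> (\<forall>a\<in>{x}. b a = (\<lambda>_. i) a)"
    using x card_N_extra[OF i(1) i'] card_nbs_v finite_nbs[of v] by (intro inj_extend) auto
  then obtain b where b: "inj_on b (nbs F v)" "b ` nbs F v \<subseteq> N (e i)" "b x = i" by auto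
  define V\<^sub>0 where "V\<^sub>0 = ?V - insert v (nbs F v)"
  define B where "B w = (if w = u then arc_slots i else block w)" for w
  define g where "g w = (if w = v then e i else if w \<in> nbs F v then b w else undefined)" for w
  have sub: "insert v (nbs F v) \<subseteq> ?V" using v_vert nbs_F[of v] by auto
  have uV: "u \<in> V\<^sub>0" using u nbs_F[of x] by (auto simp: V\<^sub>0_def)
  have "card (insert v (nbs F v)) = \<delta> + 1"
    using nbs_F[of v] finite_nbs[of v] card_nbs_v by (subst card_insert_disjoint) auto
  then have "card V\<^sub>0 = k - \<delta> - 1"
    using sub finite_F card_F finite_nbs[of v] by (simp add: V\<^sub>0_def card_Diff_subset)
  moreover have "M ^ card V\<^sub>0 \<le> card ?T"
  proof (rule power_le_card_of_choices)
    show "finite ?T" using finite_embs[OF F H] by simp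
    show "finite V\<^sub>0" using finite_F by (simp add: V\<^sub>0_def)
    show "card (B w) = M" for w by (simp add: B_def block_def arc_slots_def)
    fix c assume c: "c \<in> Pi\<^sub>E V\<^sub>0 B"
    define f where "f w = (if w \<in> V\<^sub>0 then c w else g w)" for w
    have fv: "f v = e i" by (simp add: f_def V\<^sub>0_def g_def)
    have fn: "f w = b w" if "w \<in> nbs F v" for w
      using that nbs_F[of v] by (auto simp: f_def V\<^sub>0_def g_def)
    have fu: "f u \<in> arc_slots i" using c uV by (auto simp: f_def B_def PiE_iff split: if_splits)
    have fw: "f w \<in> block w" if "w \<in> V\<^sub>0 - {u}" for w
      using c that by (auto simp: f_def B_def PiE_iff split: if_splits)
    obtain d where d: "f u = t + d" "(k + 1) * L \<le> d" "d < y i" "\<delta> + 1 \<le> d" "d \<le> t - 2"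
      "\<And>j. j < i \<Longrightarrow> y j \<le> d"
      using arc_slotsD[OF fu i] by blast
    have fuJ: "f u \<in> J" using chain_in_J d by simp
    have eJ: "e i \<in> J" using e_in_J[OF i(1) i'] .
    have NK: "N (e i) \<subseteq> K" by (rule N_subset_K[OF eJ])
    have fN: "f w \<in> N (e i)" if "w \<in> nbs F v" for w using fn that b(2) by auto
    have bound: "\<delta> < f w" "f w < (k + 1) * L" "f w \<in> K" if "w \<in> V\<^sub>0 - {u}" for w
      using block_bounds[OF _ fw[OF that]] that by (auto simp: V\<^sub>0_def)
    have not_N: "f w \<notin> N (e i)" if "w \<in> V\<^sub>0 - {u}" for w
    proof -
      have "f w \<noteq> y j" for j using bound(2)[OF that] y_ge(1)[of j] by linarith
      then show ?thesis using bound(1)[OF that] i by (auto simp: N_extra)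
    qed
    have V_eq: "?V = {v} \<union> ({u} \<union> (nbs F v \<union> (V\<^sub>0 - {u})))"
      using sub uV by (auto simp: V\<^sub>0_def)
    have "inj_on f ?V"
      unfolding V_eq
    proof (intro inj_on_Un_disjoint_image)
      show "inj_on f (nbs F v)" using b(1) fn by (simp add: inj_on_def)
      show "inj_on f (V\<^sub>0 - {u})" by (rule inj_on_block_choice[OF _ fw]) (auto simp: V\<^sub>0_def)
      show "f ` nbs F v \<inter> f ` (V\<^sub>0 - {u}) = {}" using not_N fN by fastforce
      have K: "f w \<in> K" if "w \<in> nbs F v \<union> (V\<^sub>0 - {u})" for w using that bound(3) fN NK by blast
      then show "f ` {u} \<inter> f ` (nbs F v \<union> (V\<^sub>0 - {u})) = {}" using fuJ K_J_exclusive by fastforce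
      have "f v \<noteq> f u" using d(1,5) chain_neq_e fv by metis
      then show "f ` {v} \<inter> f ` ({u} \<union> (nbs F v \<union> (V\<^sub>0 - {u}))) = {}"
        using K fv eJ K_J_exclusive by fastforce
    qed auto
    moreover have "f \<in> ?V \<rightarrow>\<^sub>E K \<union> J"
    proof (rule PiE_I)
      fix w assume "w \<in> ?V"
      then show "f w \<in> K \<union> J"
        unfolding V_eq using fv eJ fuJ bound(3) fN NK by auto
    next
      fix w assume "w \<notin> ?V"
      then show "f w = undefined" using sub by (auto simp: f_def V\<^sub>0_def g_def)
    qed
    moreover have "f w \<in> N (f z)" if zw: "(z, w) \<in> parcs F" "f z \<in> J" for z w
    proof -
      have V: "z \<in> ?V" "w \<in> ?V" "z \<noteq> w" using arc_F[OF zw(1)] by auto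
      consider "z = v" | "z = u" | "f z \<in> K"
        using V(1) bound(3) fN NK unfolding V_eq by blast
      then show ?thesis
      proof cases
        case 1
        then show ?thesis using zw(1) fN fv by (simp add: nbs_def)
      next
        case 2
        have "w \<noteq> v"
          using zw(1) u(3) arc_F 2 by (auto simp: nbs_def)
        then have "w \<in> nbs F v \<union> (V\<^sub>0 - {u})" using V 2 unfolding V_eq by auto
        then have "1 \<le> f w \<and> f w \<le> d"
        proof
          assume w: "w \<in> nbs F v"
          have "f w \<in> K" using fN[OF w] NK by auto
          moreover have "f w \<in> {i..\<delta>} \<union> y ` {1..<i}" using fN[OF w] i by (simp add: N_extra)
          ultimately show ?thesis using d(4,6) by (auto simp: K_def)
        next
          assume "w \<in> V\<^sub>0 - {u}"
          then show ?thesis using bound[of w] d(2) by linarith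
        qed
        then show ?thesis using 2 d(1,5) by (simp add: N_chain)
      next
        case 3
        then show ?thesis using zw(2) K_J_exclusive by auto
      qed
    qed
    ultimately have "f \<in> embs F H" by (simp add: embs_H_iff)
    moreover have "f x = i" using fn[OF x] b(3) by simp
    ultimately have "f \<in> ?T" using fv fu by simp
    then show "(\<lambda>w. if w \<in> V\<^sub>0 then c w else g w) \<in> ?T"
      by (simp only: f_def[abs_def])
  qed
  ultimately show ?thesis by simp
qed

text \<open>
  The vertices \<open>e (Suc i)\<close> and \<open>e i\<close> differ only in having \<open>y i\<close> or \<open>i\<close> as a neighbour. Exchanging both
  pairs fails for \<open>O(n ^ (k - \<delta> - 2))\<close> embeddings, whereas it never produces an embedding in which the
  neighbour \<open>i\<close> of \<open>e i\<close> has a neighbour in \<open>arc_slots i\<close>, as these are not adjacent to \<open>y i\<close>.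
\<close>

lemma D_extra_less:
  assumes i: "1 \<le> i" "i \<le> \<delta>"
  shows "D (e (Suc i)) < D (e i)"
proof -
  let ?V = "pverts F"
  let ?e = "e (Suc i)"
  \<comment> \<open>Other extra vertices are excluded because a set \<open>N (e l)\<close> may
    contain \<open>y i\<close> but not \<open>i\<close>, and the exchange would then destroy an
    arc.\<close>
  let ?A = "{f \<in> embs_at F H ?e. i \<notin> f ` ?V \<and> (\<forall>j\<in>{1..\<delta> + 1} - {Suc i}. e j \<notin> f ` ?V)}"
  let ?\<pi> = "id(?e := e i, y i := i)"
  let ?W = "UNIV - {e i, i}"
  let ?T = "{f \<in> embs F H. f v = e i \<and> f x = i \<and> f u \<in> arc_slots i}"
  have K: "y i \<in> K" "i \<in> K"
    using y_le_t[OF i(2)] y_ge(2)[of i] L_bounds i t_bounds by (auto simp: K_def)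
  have yi: "y i \<in> K" "y i \<noteq> i" "y i \<notin> J"
    using K K_J_exclusive \<delta>_less_y[of i] i by auto
  have iK: "i \<in> K" "i \<notin> J" using K K_J_exclusive by auto
  have eJ: "e i \<in> J" "?e \<in> J" using i by (auto intro: e_in_J)
  have ne: "?e \<noteq> y i" "e i \<noteq> i" "?e \<noteq> i" "e i \<noteq> y i" using eJ iK yi by auto
  have inj: "inj_on ?\<pi> ?W" using ne yi by (auto simp: inj_on_def)
  have Ne: "N ?e = insert (y i) ({Suc i..\<delta>} \<union> y ` {1..<i})"
    using i by (auto simp: N_extra less_Suc_eq)
  have Ne': "N (e i) = insert i ({Suc i..\<delta>} \<union> y ` {1..<i})"
    using i by (auto simp: N_extra)
  have "i \<noteq> y j" for j using \<delta>_less_y[of j] i by simp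
  then have i_notin: "i \<notin> N ?e" by (auto simp: Ne)
  have W: "f ` ?V \<subseteq> ?W" if "f \<in> ?A" for f
  proof -
    have "i \<in> {1..\<delta> + 1} - {Suc i}" using i by simp
    then show ?thesis using that by blast
  qed
  have A_embs: "compose ?V ?\<pi> f \<in> embs F H" if f: "f \<in> ?A" for f
  proof (rule compose_in_embs_H[OF _ inj W[OF f]])
    show "f \<in> embs F H" using f by (simp add: embs_at_def)
    show "?\<pi> a \<in> K" if "a \<in> K" for a using that eJ iK disj by auto
    show "?\<pi> j \<in> J" if "j \<in> J" for j using that eJ yi by auto
    fix j a assume j: "j \<in> J" "j \<in> f ` ?V" "a \<in> N j"
    have "a \<in> K" using N_subset_K j by blast
    then have a: "a \<noteq> ?e" using eJ disj by auto
    show "?\<pi> a \<in> N (?\<pi> j)"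
      using j(1)
    proof (cases rule: J_cases)
      case (1 d)
      then have Nj: "N j = {1..d}" by (simp add: N_chain)
      have "j \<noteq> ?e" using 1 chain_neq_e by simp
      moreover have "j \<noteq> y i" using j(1) yi by auto
      ultimately have "?\<pi> j = j" by simp
      moreover have "?\<pi> a \<in> {1..d}" using j(3) a 1(2) i unfolding Nj by auto
      ultimately show ?thesis by (simp only: Nj)
    next
      case (2 l)
      then have "j = ?e" using f j(2) by (auto simp: embs_at_def)
      then have "?\<pi> j = e i" using ne by simp
      moreover have "?\<pi> a \<in> N (e i)" using j(3) a \<open>j = ?e\<close> by (auto simp: Ne Ne')
      ultimately show ?thesis by (simp only:)
    qed
  qed
  have A_Y: "compose ?V ?\<pi> f \<in> embs_at F H (e i)" if f: "f \<in> ?A" for f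
  proof -
    obtain z where "z \<in> ?V" "f z = ?e" using f by (auto simp: embs_at_def)
    then have "compose ?V ?\<pi> f z = e i" using ne by (simp add: compose_def)
    then show ?thesis using A_embs[OF f] \<open>z \<in> ?V\<close> by (intro embs_atI)
  qed
  have A_T: "compose ?V ?\<pi> f \<notin> ?T" if f: "f \<in> ?A" for f
  proof
    assume T: "compose ?V ?\<pi> f \<in> ?T"
    have ux: "(u, x) \<in> parcs F" "x \<in> ?V" "u \<in> ?V" using u arc_F by (auto simp: nbs_def)
    have \<pi>x: "?\<pi> (f x) = i" and \<pi>u: "?\<pi> (f u) \<in> arc_slots i"
      using T ux by (simp_all add: compose_def)
    have "f x \<noteq> i" using f ux by auto
    then have fx: "f x = y i" using \<pi>x ne by (auto split: if_splits)
    obtain d where d: "?\<pi> (f u) = t + d" "d < y i" "\<delta> + 1 \<le> d" "d \<le> t - 2"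
      using arc_slotsD[OF \<pi>u i] by blast
    have fu: "f u = t + d"
    proof (cases "f u = ?e \<or> f u = y i")
      case True
      then have "t + d = e i \<or> t + d = i" using d(1) ne by (auto split: if_splits)
      then show ?thesis using chain_neq_e[OF d(4)] i t_bounds by auto
    qed (use d(1) in auto)
    then have "f u \<in> J" using chain_in_J d by simp
    then have "f x \<in> N (f u)" using f ux by (simp add: embs_at_def embs_H_iff)
    then show False using fx fu d by (simp add: N_chain)
  qed
  show ?thesis
  proof (rule card_less_by_injection[where A = ?A and \<phi> = "compose ?V ?\<pi>" and T = ?T])
    show "inj_on (compose ?V ?\<pi>) ?A"
      by (rule inj_on_compose[OF inj, of _ F H]) (use W in \<open>auto simp: embs_at_def\<close>)
    show "?T \<subseteq> embs_at F H (e i)" using v_vert by (auto intro: embs_atI)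
    show "compose ?V ?\<pi> ` ?A \<subseteq> embs_at F H (e i)" using A_Y by blast
    show "?T \<inter> compose ?V ?\<pi> ` ?A = {}" using A_T by (rule disjoint_imageI)
    \<comment> \<open>An exception covers \<open>e (Suc i)\<close>, its \<delta> neighbours and one
      further vertex, \<delta> + 2 in all.\<close>
    have "card (embs_at F H ?e - ?A) < M ^ Suc (k - \<delta> - 2)"
    proof (rule card_covering_family_less)
      let ?Z = "insert i (e ` ({1..\<delta> + 1} - {Suc i}))"
      let ?S = "\<lambda>z. insert z (insert ?e (N ?e))"
      show "embs_at F H ?e - ?A \<subseteq> (\<Union>z\<in>?Z. {f \<in> embs F H. ?S z \<subseteq> f ` ?V})"
      proof
        fix f assume f: "f \<in> embs_at F H ?e - ?A"
        then have "N ?e \<subseteq> f ` ?V" using N_extra_covered[of f "Suc i"] i by (simp add: embs_at_def)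
        moreover obtain z where "z \<in> ?Z" "z \<in> f ` ?V" using f by blast
        ultimately show "f \<in> (\<Union>z\<in>?Z. {f \<in> embs F H. ?S z \<subseteq> f ` ?V})"
          using f by (intro UN_I[of z]) (auto simp: embs_at_def)
      qed
      have "card ?Z \<le> Suc (card (e ` ({1..\<delta> + 1} - {Suc i})))" by (simp add: card_insert_le_m1)
      also have "card (e ` ({1..\<delta> + 1} - {Suc i})) \<le> card ({1..\<delta> + 1} - {Suc i})"
        by (rule card_image_le) simp
      also have "card ({1..\<delta> + 1} - {Suc i}) = \<delta>" using i by simp
      finally show "card ?Z \<le> k" using \<delta>_k by simp
      fix z assume z: "z \<in> ?Z"
      have finN: "finite (N ?e)" using Ne by simp
      have zJ: "z = i \<or> z \<in> J" using z by (auto intro: e_in_J)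
      have "N ?e \<subseteq> K" by (rule N_subset_K[OF eJ(2)])
      then have "z \<notin> N ?e" "?e \<notin> N ?e" using zJ i_notin eJ disj by auto
      moreover have "z \<noteq> ?e" using z ne by auto
      ultimately have "card (?S z) = \<delta> + 2" using finN card_N_extra[of "Suc i"] i by simp
      then show "finite (?S z) \<and> card (?S z) = k - (k - \<delta> - 2)" using finN \<delta>_k by simp
    qed auto
    also have "Suc (k - \<delta> - 2) = k - \<delta> - 1" using \<delta>_k by simp
    also have "M ^ (k - \<delta> - 1) \<le> card ?T" by (rule card_extra_choices[OF i])
    finally show "card (embs_at F H ?e - ?A) < card ?T" .
  qed (auto simp: finite_embs_at[OF F H])
qed

end

context sparse_construction
begin

text \<open>Only one edge is fixed. All blocks lie below \<open>p\<close>, so they are joined to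
  \<open>t + p\<close> and the other \<open>k - 2\<close> vertices are free; \<open>p'\<close> lies
  above \<open>p\<close> and is not joined to \<open>t + p\<close>.\<close>

lemma card_edge_choices:
  assumes p: "(k + 1) * L \<le> p" "p \<le> t - 2" "p < p'" "p' \<le> t"
  shows "M ^ (k - 2) \<le>
    card {f \<in> embs F H. f x\<^sub>0 = t + p \<and> f x\<^sub>1 = p \<and> p' \<notin> f ` pverts F}" (is "_ \<le> card ?T")
proof -
  let ?V = "pverts F"
  define V\<^sub>0 where "V\<^sub>0 = ?V - {x\<^sub>0, x\<^sub>1}"
  define g where "g w = (if w = x\<^sub>0 then t + p else if w = x\<^sub>1 then p else undefined)" for w
  have xs: "x\<^sub>0 \<in> ?V" "x\<^sub>1 \<in> ?V" "x\<^sub>0 \<noteq> x\<^sub>1" using x\<^sub>1 arc_F by (auto simp: nbs_def)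
  have "L \<le> (k + 1) * L" by simp
  then have p_ge: "\<delta> + 1 \<le> p" using p L_bounds \<delta>_k by linarith
  then have pK: "p \<in> K" and pJ: "t + p \<in> J" using p chain_in_J by (auto simp: K_def)
  have "card V\<^sub>0 = k - 2"
    using xs finite_F card_F by (simp add: V\<^sub>0_def card_Diff_subset)
  moreover have "M ^ card V\<^sub>0 \<le> card ?T"
  proof (rule power_le_card_of_choices)
    show "finite ?T" using finite_embs[OF F H] by simp
    show "finite V\<^sub>0" using finite_F by (simp add: V\<^sub>0_def)
    show "card (block w) = M" for w by (simp add: block_def)
    fix c assume c: "c \<in> Pi\<^sub>E V\<^sub>0 block"
    define f where "f w = (if w \<in> V\<^sub>0 then c w else g w)" for w
    have f0: "f x\<^sub>0 = t + p" and f1: "f x\<^sub>1 = p" using xs by (auto simp: f_def V\<^sub>0_def g_def)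
    have fw: "f w \<in> block w" if "w \<in> V\<^sub>0" for w using c that by (auto simp: f_def)
    have bound: "\<delta> < f w" "f w < (k + 1) * L" "f w \<in> K" if "w \<in> V\<^sub>0" for w
      using block_bounds[OF _ fw[OF that]] that by (auto simp: V\<^sub>0_def)
    have V_eq: "?V = {x\<^sub>0} \<union> ({x\<^sub>1} \<union> V\<^sub>0)" using xs by (auto simp: V\<^sub>0_def)
    have "inj_on f ?V"
      unfolding V_eq
    proof (intro inj_on_Un_disjoint_image)
      show "inj_on f V\<^sub>0" by (rule inj_on_block_choice[OF _ fw]) (auto simp: V\<^sub>0_def)
      have "f w \<noteq> p" if "w \<in> V\<^sub>0" for w using bound(2)[OF that] p by linarith
      then show "f ` {x\<^sub>1} \<inter> f ` V\<^sub>0 = {}" using f1 by fastforce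
      show "f ` {x\<^sub>0} \<inter> f ` ({x\<^sub>1} \<union> V\<^sub>0) = {}"
        using f0 f1 pJ pK bound(3) K_J_exclusive by fastforce
    qed auto
    moreover have "f \<in> ?V \<rightarrow>\<^sub>E K \<union> J"
    proof (rule PiE_I)
      fix w assume "w \<in> ?V"
      then show "f w \<in> K \<union> J" unfolding V_eq using f0 f1 pJ pK bound(3) by auto
    next
      fix w assume "w \<notin> ?V"
      then show "f w = undefined" using xs by (auto simp: f_def V\<^sub>0_def g_def)
    qed
    moreover have "f w \<in> N (f z)" if zw: "(z, w) \<in> parcs F" "f z \<in> J" for z w
    proof -
      have V: "z \<in> ?V" "w \<in> ?V" "z \<noteq> w" using arc_F[OF zw(1)] by auto
      have "z = x\<^sub>0"
        using V(1) zw(2) f1 pK bound(3) K_J_exclusive unfolding V_eq by auto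
      then have "w \<in> {x\<^sub>1} \<union> V\<^sub>0" using V unfolding V_eq by auto
      then have "1 \<le> f w \<and> f w \<le> p"
      proof
        assume "w \<in> V\<^sub>0"
        then show ?thesis using bound(1,2)[of w] p(1) by linarith
      qed (use f1 p_ge in auto)
      then show ?thesis using \<open>z = x\<^sub>0\<close> f0 p by (simp add: N_chain)
    qed
    ultimately have "f \<in> embs F H" by (simp add: embs_H_iff)
    moreover have "f w \<noteq> p'" if "w \<in> ?V" for w
      using that f0 f1 p p_ge bound(2)[of w] t_bounds unfolding V_eq by auto
    ultimately have "f \<in> ?T" using f0 f1 by auto
    then show "(\<lambda>w. if w \<in> V\<^sub>0 then c w else g w) \<in> ?T"
      by (simp only: f_def[abs_def])
  qed
  ultimately show ?thesis by simp
qed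

text \<open>
  Compared with \<open>p\<close>, the vertex \<open>y j\<close> lacks the neighbour \<open>t + p\<close> but has some neighbours \<open>e i\<close>. For
  \<open>\<delta> \<ge> 2\<close> the latter contribute fewer embeddings by an order of magnitude. For \<open>\<delta> = 1\<close> the orders agree,
  but \<open>e 2\<close> can only host a leaf of \<open>F\<close>, so exchanging \<open>e 2\<close> for \<open>t + p\<close> misses the embeddings with a
  vertex of degree two at \<open>t + p\<close>.
\<close>

lemma D_fill_less:
  assumes j: "1 \<le> j" "j \<le> \<delta>" and p: "(k + 1) * L \<le> p" "p \<le> t - 2" "p < y j"
  shows "D (y j) < D p"
proof (rule card_embs_at_less[OF F H])
  let ?V = "pverts F"
  let ?q = "y j"
  let ?X = "{f \<in> embs_at F H ?q. p \<notin> f ` ?V}"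
  let ?Y = "{f \<in> embs_at F H p. ?q \<notin> f ` ?V}"
  let ?T = "{f \<in> embs F H. f x\<^sub>0 = t + p \<and> f x\<^sub>1 = p \<and> ?q \<notin> f ` ?V}"
  let ?\<pi> = "id(?q := p)"
  have xs: "x\<^sub>0 \<in> ?V" "x\<^sub>1 \<in> ?V" "(x\<^sub>0, x\<^sub>1) \<in> parcs F" using x\<^sub>1 arc_F by (auto simp: nbs_def)
  have "L \<le> (k + 1) * L" by simp
  then have p_ge: "\<delta> + 1 \<le> p" using p L_bounds \<delta>_k by linarith
  then have K: "p \<in> K" "?q \<in> K" and pJ: "t + p \<in> J"
    using p chain_in_J y_le_t[OF j(2)] by (auto simp: K_def)
  then have neK: "?q \<noteq> t + p" "p \<noteq> t + p" using K_J_exclusive by metis+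
  have fin: "finite ?X" "finite ?Y" using finite_embs_at[OF F H] by auto
  have TY: "?T \<subseteq> ?Y" using xs by (auto intro: embs_atI)
  have card_T: "M ^ (k - 2) \<le> card ?T" using card_edge_choices[OF p] y_le_t[OF j(2)] .
  have inj: "inj_on ?\<pi> (UNIV - {p})" by (auto simp: inj_on_def)
  \<comment> \<open>Chain sets are initial segments and contain \<open>p\<close> whenever they
    contain \<open>y j\<close>; only extra vertices joined to \<open>y j\<close> obstruct the
    exchange.\<close>
  have swap: "compose ?V ?\<pi> f \<in> ?Y" "compose ?V ?\<pi> f \<notin> ?T"
    if f: "f \<in> ?X" and no: "\<And>w. w \<in> extra \<Longrightarrow> ?q \<in> N w \<Longrightarrow> w \<notin> f ` ?V" for f
  proof -
    have f': "f \<in> embs F H" "p \<notin> f ` ?V" "?q \<in> f ` ?V" using f by (auto simp: embs_at_def)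
    have "compose ?V ?\<pi> f \<in> embs F H"
    proof (rule compose_in_embs_H[OF f'(1) inj])
      show "f ` ?V \<subseteq> UNIV - {p}" using f' by auto
      show "?\<pi> a \<in> K" if "a \<in> K" for a using that K by auto
      have \<pi>J: "?\<pi> w = w" if "w \<in> J" for w using that K K_J_exclusive by auto
      then show "?\<pi> w \<in> J" if "w \<in> J" for w using that by simp
      fix w a assume w: "w \<in> J" "w \<in> f ` ?V" "a \<in> N w"
      have "?\<pi> a \<in> N w"
      proof (cases "a = ?q")
        case True
        then have "w \<in> chain" using no w by (auto simp: J_def)
        then obtain d where "w = t + d" "d \<le> t - 2" by (auto simp: chain_iff)
        then show ?thesis using True w(3) p p_ge by (simp add: N_chain)
      qed (use w in auto)
      then show "?\<pi> a \<in> N (?\<pi> w)" using \<pi>J[OF w(1)] by simp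
    qed
    moreover obtain z where z: "z \<in> ?V" "f z = ?q" using f'(3) by auto
    moreover have "?q \<notin> compose ?V ?\<pi> f ` ?V"
      using p(3) by (auto simp: compose_def split: if_splits)
    moreover have "compose ?V ?\<pi> f z = p" using z by (simp add: compose_def)
    ultimately show "compose ?V ?\<pi> f \<in> ?Y" by (auto intro: embs_atI)
    show "compose ?V ?\<pi> f \<notin> ?T"
    proof
      assume "compose ?V ?\<pi> f \<in> ?T"
      then have "?\<pi> (f x\<^sub>0) = t + p" "?\<pi> (f x\<^sub>1) = p" using xs by (simp_all add: compose_def)
      moreover have "f x\<^sub>1 \<noteq> p" using f'(2) xs by auto
      ultimately have "f x\<^sub>0 = t + p" "f x\<^sub>1 = ?q" using neK by (auto split: if_splits)
      then have "?q \<in> N (t + p)" using f'(1) xs pJ unfolding embs_H_iff by metis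
      then show False using p by (simp add: N_chain)
    qed
  qed
  show "card ?X < card ?Y"
  proof (cases "2 \<le> \<delta>")
    case True
    let ?A = "{f \<in> ?X. \<forall>i\<in>{1..\<delta> + 1}. e i \<notin> f ` ?V}"
    have no: "w \<notin> f ` ?V" if "f \<in> ?A" "w \<in> extra" for f w
      using that by (auto simp: extra_iff)
    have A: "compose ?V ?\<pi> f \<in> ?Y" "compose ?V ?\<pi> f \<notin> ?T" if f: "f \<in> ?A" for f
    proof -
      have X: "f \<in> ?X" using f by simp
      show "compose ?V ?\<pi> f \<in> ?Y" by (rule swap(1)[OF X no[OF f]])
      show "compose ?V ?\<pi> f \<notin> ?T" by (rule swap(2)[OF X no[OF f]])
    qed
    show ?thesis
    proof (rule card_less_by_injection[OF fin, where A = ?A and \<phi> = "compose ?V ?\<pi>" and T = ?T])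
      show "inj_on (compose ?V ?\<pi>) ?A"
        by (rule inj_on_compose[OF inj, of _ F H]) (auto simp: embs_at_def)
      show "compose ?V ?\<pi> ` ?A \<subseteq> ?Y" using A(1) by (rule image_subsetI)
      show "?T \<inter> compose ?V ?\<pi> ` ?A = {}" using A(2) by (rule disjoint_imageI)
      \<comment> \<open>An exception covers some \<open>e i\<close> and its \<delta> neighbours. As
        \<open>\<delta> \<ge> 2\<close>, at most \<open>k - 3\<close> vertices stay free, against
        \<open>k - 2\<close> in \<open>?T\<close>.\<close>
      have "card (?X - ?A) < M ^ Suc (k - \<delta> - 1)"
      proof (rule card_covering_family_less)
        let ?S = "\<lambda>i. insert (e i) (N (e i))"
        show "?X - ?A \<subseteq> (\<Union>i\<in>{1..\<delta> + 1}. {f \<in> embs F H. ?S i \<subseteq> f ` ?V})"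
        proof
          fix f assume f: "f \<in> ?X - ?A"
          then obtain i where i: "i \<in> {1..\<delta> + 1}" "e i \<in> f ` ?V" by blast
          moreover have "f \<in> embs F H" using f by (simp add: embs_at_def)
          moreover from this have "N (e i) \<subseteq> f ` ?V" using N_extra_covered i by simp
          ultimately show "f \<in> (\<Union>i\<in>{1..\<delta> + 1}. {f \<in> embs F H. ?S i \<subseteq> f ` ?V})"
            by blast
        qed
        show "card {1..\<delta> + 1} \<le> k" using \<delta>_k by simp
        fix i assume i: "i \<in> {1..\<delta> + 1}"
        then have "e i \<in> J" by (simp add: e_in_J)
        then have "e i \<notin> N (e i)" using N_subset_K K_J_exclusive by blast
        moreover have "finite (N (e i))" using i by (simp add: N_extra)
        ultimately show "finite (?S i) \<and> card (?S i) = k - (k - \<delta> - 1)"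
          using card_N_extra[of i] i \<delta>_k by simp
      qed auto
      also have "M ^ Suc (k - \<delta> - 1) \<le> M ^ (k - 2)"
        using True \<delta>_k k_less_M by (intro power_increasing) auto
      finally show "card (?X - ?A) < card ?T" using card_T by simp
    qed (use TY in auto)
  next
    case False
    then have \<delta>1: "\<delta> = 1" using \<delta>_pos by simp
    then have j1: "j = 1" using j by simp
    have "1 \<le> i \<and> i \<le> \<delta> + 1 \<longleftrightarrow> i = 1 \<or> i = 2" for i using \<delta>1 by auto
    then have "w \<in> extra \<longleftrightarrow> (\<exists>i. w = e i \<and> (i = 1 \<or> i = 2))" for w
      by (simp only: extra_iff)
    then have extra: "w \<in> extra \<longleftrightarrow> w = e 1 \<or> w = e 2" for w
      by auto
    have N1: "N (e 1) = {1}" using N_extra[of 1] \<delta>1 by simp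
    have "{2..\<delta>} = {}" "{1..<2} = {j}" using \<delta>1 j1 by auto
    then have N2: "N (e 2) = {?q}" using N_extra[of 2] by simp
    have q1: "?q \<noteq> 1" using \<delta>_less_y[of j] \<delta>1 by simp
    have qt: "?q = t" unfolding t_def using \<delta>1 j1 by simp
    have e2J: "e 2 \<in> J" using e_in_J[of 2] \<delta>1 by simp
    have e2: "e 2 \<noteq> ?q" "e 2 \<noteq> p" "e 2 \<noteq> t + p"
      using e2J K K_J_exclusive chain_neq_e[OF p(2), of 2] by metis+
    \<comment> \<open>Now \<open>e 2\<close> is the only extra vertex joined to \<open>y j\<close>.
      It moves to \<open>t + p\<close>, so an exception must contain both, together with
      \<open>y j\<close>.\<close>
    let ?A = "{f \<in> ?X. \<not> (e 2 \<in> f ` ?V \<and> t + p \<in> f ` ?V)}"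
    let ?\<pi>' = "id(?q := p, e 2 := t + p)"
    let ?W = "UNIV - {p, t + p}"
    let ?\<phi> = "\<lambda>f. if e 2 \<in> f ` ?V then compose ?V ?\<pi>' f else compose ?V ?\<pi> f"
    have inj': "inj_on ?\<pi>' ?W" using neK e2 by (auto simp: inj_on_def)
    have swap_no: "\<And>w. w \<in> extra \<Longrightarrow> ?q \<in> N w \<Longrightarrow> w \<notin> f ` ?V" if "e 2 \<notin> f ` ?V" for f
      using that N1 q1 unfolding extra by (metis singletonD)
    have swap': "compose ?V ?\<pi>' f \<in> ?Y" if f: "f \<in> ?A" "e 2 \<in> f ` ?V" for f
    proof -
      have f': "f \<in> embs F H" "p \<notin> f ` ?V" "?q \<in> f ` ?V" "t + p \<notin> f ` ?V"
        using f by (auto simp: embs_at_def)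
      have "compose ?V ?\<pi>' f \<in> embs F H"
      proof (rule compose_in_embs_H[OF f'(1) inj'])
        show "f ` ?V \<subseteq> ?W" using f'(2,4) by blast
        show "?\<pi>' a \<in> K" if "a \<in> K" for a using that K e2J K_J_exclusive by auto
        show "?\<pi>' w \<in> J" if "w \<in> J" for w using that K pJ K_J_exclusive by auto
        fix w a assume w: "w \<in> J" "w \<in> f ` ?V" "a \<in> N w"
        have "a \<in> K" using w N_subset_K by blast
        then have a: "a \<noteq> e 2" using e2J K_J_exclusive by auto
        have wq: "w \<noteq> ?q" using w K K_J_exclusive by auto
        show "?\<pi>' a \<in> N (?\<pi>' w)"
        proof (cases "w = e 2")
          case True
          then have "?\<pi>' w = t + p" "?\<pi>' a = p" using w(3) N2 e2 by auto
          moreover have "p \<in> N (t + p)" using p p_ge by (simp add: N_chain)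
          ultimately show ?thesis by (simp only:)
        next
          case False
          then have \<pi>w: "?\<pi>' w = w" using wq by simp
          have "a \<noteq> ?q"
            using w(1)
          proof (cases rule: J_cases)
            case (1 d)
            then show ?thesis using w(3) qt t_bounds by (auto simp: N_chain)
          next
            case (2 i)
            then have "i \<noteq> 2" using False by auto
            then have "i = 1" using 2 \<delta>1 by linarith
            then have "w = e 1" using 2 by simp
            then show ?thesis using w(3) N1 q1 by auto
          qed
          then have "?\<pi>' a = a" using a by simp
          then show ?thesis using w(3) \<pi>w by (simp only:)
        qed
      qed
      moreover obtain z where z: "z \<in> ?V" "f z = ?q" using f'(3) by auto
      moreover have "?q \<notin> compose ?V ?\<pi>' f ` ?V"
        using p(3) neK by (auto simp: compose_def split: if_splits)
      moreover have "compose ?V ?\<pi>' f z = p" using z e2 by (simp add: compose_def)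
      ultimately show ?thesis by (auto intro: embs_atI)
    qed
    have nb: "\<exists>z z'. (z, z') \<in> parcs F \<and> f z = e 2 \<and> f z' = ?q"
      if f: "f \<in> embs F H" "e 2 \<in> f ` ?V" for f
    proof -
      obtain z where z: "z \<in> ?V" "f z = e 2" using f(2) by auto
      then have "nbs F z \<noteq> {}" using min_deg[OF z(1)] \<delta>1 by auto
      then obtain z' where z': "(z, z') \<in> parcs F" by (auto simp: nbs_def)
      have "f z \<in> J" using z e2J by simp
      then have "f z' \<in> N (f z)" using f(1) z' unfolding embs_H_iff by metis
      then show ?thesis using z z' N2 by auto
    qed
    show ?thesis
    proof (rule card_less_by_injection[OF fin, where A = ?A and \<phi> = ?\<phi> and T = ?T])
      show "inj_on ?\<phi> ?A"
      proof -
        let ?A1 = "{f \<in> ?A. e 2 \<in> f ` ?V}"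
        let ?A2 = "{f \<in> ?A. e 2 \<notin> f ` ?V}"
        have "inj_on ?\<phi> ?A1"
          using inj_on_compose[OF inj', of ?A1 F H] by (subst inj_on_cong) (auto simp: embs_at_def)
        moreover have "inj_on ?\<phi> ?A2"
          using inj_on_compose[OF inj, of ?A2 F H] by (subst inj_on_cong) (auto simp: embs_at_def)
        \<comment> \<open>The first branch yields an edge between \<open>t + p\<close> and
          \<open>p\<close>. In the second branch it would come from an edge between
          \<open>t + p\<close> and \<open>y j\<close>, which are not adjacent.\<close>
        moreover have "?\<phi> f \<noteq> ?\<phi> g" if f: "f \<in> ?A1" and g: "g \<in> ?A2" for f g
        proof
          assume eq: "?\<phi> f = ?\<phi> g"
          obtain z z' where z: "(z, z') \<in> parcs F" "f z = e 2" "f z' = ?q"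
            using nb[of f] f by (auto simp: embs_at_def)
          have V: "z \<in> ?V" "z' \<in> ?V" using arc_F[OF z(1)] by auto
          have "compose ?V ?\<pi>' f = compose ?V ?\<pi> g" using eq f g by simp
          then have "?\<pi>' (f w) = ?\<pi> (g w)" if "w \<in> ?V" for w
            using that by (auto simp: compose_def dest: fun_cong[of _ _ w] split: if_splits)
          from this[of z] this[of z'] have "?\<pi> (g z) = t + p" "?\<pi> (g z') = p"
            using V z e2 by auto
          moreover have "g z' \<noteq> p" using g V by auto
          ultimately have gz: "g z = t + p" "g z' = ?q" using neK by (auto split: if_splits)
          moreover have "g \<in> embs F H" using g by (simp add: embs_at_def)
          ultimately have "?q \<in> N (t + p)" using z(1) pJ unfolding embs_H_iff by metis
          then show False using p by (simp add: N_chain)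
        qed
        then have "?\<phi> ` ?A1 \<inter> ?\<phi> ` ?A2 = {}" by blast
        ultimately have "inj_on ?\<phi> (?A1 \<union> ?A2)" by (rule inj_on_Un_disjoint_image)
        moreover have "?A = ?A1 \<union> ?A2" by blast
        ultimately show ?thesis by (simp only:)
      qed
      show "?\<phi> ` ?A \<subseteq> ?Y"
      proof (rule image_subsetI)
        fix f assume f: "f \<in> ?A"
        then have X: "f \<in> ?X" by simp
        show "?\<phi> f \<in> ?Y"
        proof (cases "e 2 \<in> f ` ?V")
          case True
          show ?thesis using swap'[OF f True] unfolding if_P[OF True] .
        next
          case False
          show ?thesis using swap(1)[OF X swap_no[OF False]] unfolding if_not_P[OF False] .
        qed
      qed
      have "?\<phi> f \<notin> ?T" if f: "f \<in> ?A" for f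
      proof (cases "e 2 \<in> f ` ?V")
        case True
        have f': "f \<in> embs F H" "t + p \<notin> f ` ?V" using f True by (auto simp: embs_at_def)
        show ?thesis
        proof
          assume "?\<phi> f \<in> ?T"
          then have "?\<pi>' (f x\<^sub>0) = t + p" using True xs by (simp add: compose_def)
          moreover have "f x\<^sub>0 \<noteq> t + p" using f'(2) xs(1) by (metis image_eqI)
          ultimately have fx: "f x\<^sub>0 = e 2" using neK by (auto split: if_splits)
          then have J: "f x\<^sub>0 \<in> J" using e2J by simp
          have "f w \<in> N (f x\<^sub>0)" if "w \<in> nbs F x\<^sub>0" for w
            using f'(1) J that unfolding embs_H_iff nbs_def by blast
          then have "f ` nbs F x\<^sub>0 \<subseteq> {?q}" using fx N2 by auto
          then have "card (f ` nbs F x\<^sub>0) \<le> card {?q}" by (intro card_mono) auto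
          moreover have "inj_on f (nbs F x\<^sub>0)"
            using embsD(2)[OF f'(1)] nbs_F[of x\<^sub>0] by (meson Diff_subset inj_on_subset subset_trans)
          ultimately show False using deg_x\<^sub>0 by (simp add: card_image)
        qed
      next
        case False
        have X: "f \<in> ?X" using f by simp
        show ?thesis using swap(2)[OF X swap_no[OF False]] unfolding if_not_P[OF False] .
      qed
      then show "?T \<inter> ?\<phi> ` ?A = {}" by (rule disjoint_imageI)
      have "card (?X - ?A) < M ^ Suc (k - 3)"
      proof (rule card_covering_family_less)
        show "?X - ?A \<subseteq> (\<Union>z\<in>{()}. {f \<in> embs F H. {?q, e 2, t + p} \<subseteq> f ` ?V})"
          by (auto simp: embs_at_def)
        show "finite {?q, e 2, t + p} \<and> card {?q, e 2, t + p} = k - (k - 3)"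
          using e2 neK \<delta>_k \<delta>1 by simp
      qed (use \<delta>_k in auto)
      also have "Suc (k - 3) = k - 2" using \<delta>_k \<delta>1 by simp
      finally show "card (?X - ?A) < card ?T" using card_T by simp
    qed (use TY in auto)
  qed
qed

end

section \<open>Incomplete patterns: ordering all degrees\<close>

context sparse_construction
begin

lemma y_gap: "i < j \<Longrightarrow> y i + L \<le> y j"
proof -
  assume "i < j"
  then have "(k + 1 + i + 1) * L \<le> (k + 1 + j) * L" by (intro mult_right_mono) auto
  then show ?thesis by (simp add: y_def algebra_simps)
qed

lemma y_near: "y i \<noteq> y j - 1" "y i \<noteq> y j - 2"
proof -
  have "y j - 2 < y j" "y j - 1 < y j" using y_ge(2)[of j] L_bounds by linarith+
  then show "y i \<noteq> y j - 1" "y i \<noteq> y j - 2"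
    using y_gap[of i j] y_mono[of j i] L_bounds by (cases i j rule: linorder_cases; simp)+
qed

text \<open>Below the top, a clique vertex that is no \<open>y j\<close> has only chain vertices as
  neighbours in \<open>J\<close>, so nesting applies; \<open>t + p\<close> gives strictness.\<close>

lemma D_less_of_unfilled:
  assumes p: "\<delta> + 1 \<le> p" "p \<le> t - 2" "p < q" "q \<le> t" and q: "\<And>j. j \<in> {1..\<delta>} \<Longrightarrow> q \<noteq> y j"
  shows "D q < D p"
proof (rule D_clique_less)
  show "q \<in> K" "p \<in> K" using p by (auto simp: K_def)
  show "{j \<in> J. q \<in> N j} \<subset> {j \<in> J. p \<in> N j}"
  proof
    show "{j \<in> J. q \<in> N j} \<subseteq> {j \<in> J. p \<in> N j}"
    proof clarify
      fix j assume j: "j \<in> J" "q \<in> N j"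
      show "p \<in> N j"
        using j(1)
      proof (cases rule: J_cases)
        case (1 d)
        then show ?thesis using j(2) p by (simp add: N_chain)
      next
        case (2 i)
        then have "q \<in> y ` {1..<i}" using j(2) p by (simp add: N_extra)
        then obtain l where l: "q = y l" "1 \<le> l" "l < i" by auto
        then have "l \<in> {1..\<delta>}" using 2(3) by simp
        then show ?thesis using q l(1) by blast
      qed
    qed
    have "t + p \<in> J" using chain_in_J p by simp
    moreover have "N (t + p) = {1..p}" using p by (simp add: N_chain)
    ultimately have "t + p \<in> {j \<in> J. p \<in> N j}" "t + p \<notin> {j \<in> J. q \<in> N j}" using p by auto
    then show "{j \<in> J. q \<in> N j} \<noteq> {j \<in> J. p \<in> N j}" by blast
  qed
qed

text \<open>For \<open>q = y j\<close> nesting fails, so an unfilled vertex \<open>r\<close> just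
  above it in the order is inserted: \<open>D_fill_less\<close> compares \<open>q\<close> with
  \<open>r\<close>, and nesting compares \<open>r\<close> with \<open>p\<close>.\<close>

lemma D_decreasing:
  assumes p: "\<delta> + 1 \<le> p" "p \<le> t - 2" "p < q" "q \<le> t"
  shows "D q < D p"
proof (cases "\<exists>j\<in>{1..\<delta>}. q = y j")
  case False
  then show ?thesis using D_less_of_unfilled[OF p] by blast
next
  case True
  then obtain j where j: "1 \<le> j" "j \<le> \<delta>" "q = y j" by auto
  \<comment> \<open>For \<open>j = \<delta>\<close> the vertex \<open>t - 1\<close> is skipped,
    since \<open>t + (t - 1)\<close> is not in the chain.\<close>
  define r where "r = (if j = \<delta> then t - 2 else y j - 1)"
  have "y 0 + L \<le> y j" using y_gap[of 0 j] j by simp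
  then have y_ge': "(k + 1) * L + L \<le> y j" by (simp add: y_def)
  have r: "(k + 1) * L \<le> r" "r \<le> t - 2" "r < y j" "p \<le> r"
  proof -
    have "y j + L \<le> t" if "j \<noteq> \<delta>" using y_gap[of j \<delta>] that j by (simp add: t_def)
    moreover have "y j = t" if "j = \<delta>" using that by (simp add: t_def)
    ultimately show "(k + 1) * L \<le> r" "r \<le> t - 2" "r < y j" "p \<le> r"
      unfolding r_def using y_ge' L_bounds p j t_bounds(1) by (cases "j = \<delta>"; simp)+
  qed
  have less: "D q < D r" using D_fill_less[OF j(1,2) r(1-3)] j(3) by simp
  show ?thesis
  proof (cases "p = r")
    case False
    have "r \<noteq> y i" for i
      unfolding r_def t_def using y_near[of i j] y_near[of i \<delta>] by (cases "j = \<delta>") auto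
    then have "D r < D p" using r p False by (intro D_less_of_unfilled) auto
    then show ?thesis using less by simp
  qed (use less in simp)
qed

text \<open>Neither vertex lies in a chain set; \<open>t = y \<delta>\<close> fills
  \<open>N (e (\<delta> + 1))\<close>, whereas \<open>t - 1\<close> fills no set.\<close>

lemma D_last_less: "D (t - 1) < D t"
proof (rule D_clique_less)
  show "t - 1 \<in> K" "t \<in> K" using t_bounds by (auto simp: K_def)
  have "t - 1 \<notin> N j" if "j \<in> J" for j
    using that
  proof (cases rule: J_cases)
    case (1 d)
    then have "N j = {1..d}" by (simp add: N_chain)
    then show ?thesis using 1 t_bounds by auto
  next
    case (2 i)
    have "t - 1 \<noteq> y l" for l using y_near(1)[of l \<delta>] by (simp add: t_def)
    then show ?thesis using 2 t_bounds by (auto simp: N_extra)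
  qed
  moreover have "e (\<delta> + 1) \<in> J" "t \<in> N (e (\<delta> + 1))"
    using e_in_J[of "\<delta> + 1"] \<delta>_pos by (auto simp: N_extra t_def)
  ultimately show "{j \<in> J. t - 1 \<in> N j} \<subset> {j \<in> J. t \<in> N j}" by blast
qed

lemma low_in_N_extra_iff: "1 \<le> i \<Longrightarrow> p \<le> \<delta> + 1 \<Longrightarrow> p \<in> N (e i) \<longleftrightarrow> i \<le> p \<and> p \<le> \<delta>"
proof -
  assume i: "1 \<le> i" "p \<le> \<delta> + 1"
  have "p \<noteq> y l" for l using i y_ge(2)[of l] L_bounds \<delta>_k by linarith
  then show ?thesis using i by (auto simp: N_extra)
qed

text \<open>The sets \<open>N (e i)\<close> lose the top vertices in increasing order, and
  \<open>e q\<close> has lost \<open>p\<close> but not yet \<open>q\<close>.\<close>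

lemma D_top_less:
  assumes p: "1 \<le> p" "p < q" "q \<le> \<delta>"
  shows "D p < D q"
proof (rule D_clique_less)
  show "p \<in> K" "q \<in> K" using p t_bounds by (auto simp: K_def)
  have "q \<in> N j" if "j \<in> J" "p \<in> N j" for j
    using that(1)
  proof (cases rule: J_cases)
    case (1 d)
    then show ?thesis using p by (simp add: N_chain)
  next
    case (2 i)
    then show ?thesis using that(2) p by (simp add: low_in_N_extra_iff)
  qed
  moreover have "e q \<in> J" "q \<in> N (e q)" "p \<notin> N (e q)"
    using p e_in_J[of q] by (auto simp: low_in_N_extra_iff)
  ultimately show "{j \<in> J. p \<in> N j} \<subset> {j \<in> J. q \<in> N j}" by blast
qed

lemma D_below_top:
  assumes p: "1 \<le> p" "p \<le> \<delta>"
  shows "D (\<delta> + 1) < D p"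
proof (rule D_clique_less)
  show "p \<in> K" "\<delta> + 1 \<in> K" using p t_bounds by (auto simp: K_def)
  have "p \<in> N j" if "j \<in> J" "\<delta> + 1 \<in> N j" for j
    using that(1)
  proof (cases rule: J_cases)
    case (1 d)
    then show ?thesis using p by (simp add: N_chain)
  next
    case (2 i)
    then show ?thesis using that(2) by (simp add: low_in_N_extra_iff)
  qed
  moreover have "e 1 \<in> J" "p \<in> N (e 1)" "\<delta> + 1 \<notin> N (e 1)"
    using p e_in_J[of 1] by (auto simp: low_in_N_extra_iff)
  ultimately show "{j \<in> J. \<delta> + 1 \<in> N j} \<subset> {j \<in> J. p \<in> N j}" by blast
qed

lemma D_inj_clique:
  assumes "p \<in> K" "q \<in> K" "p < q"
  shows "D p \<noteq> D q"
proof -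
  have pq: "1 \<le> p" "q \<le> t" using assms by (auto simp: K_def)
  have \<delta>t: "\<delta> + 1 \<le> t - 2" using t_bounds by simp
  consider "q \<le> \<delta>" | "p \<le> \<delta>" "\<delta> < q" | "\<delta> < p" "p \<le> t - 2" | "p = t - 1" "q = t"
    using assms(3) pq by linarith
  then show ?thesis
  proof cases
    case 1
    then show ?thesis using D_top_less[OF pq(1) assms(3)] by simp
  next
    case 2
    have "D q \<le> D (\<delta> + 1)"
      using D_decreasing[of "\<delta> + 1" q] \<delta>t 2 pq by (cases "q = \<delta> + 1") auto
    then show ?thesis using D_below_top[OF pq(1) 2(1)] by simp
  next
    case 3
    then show ?thesis using D_decreasing[of p q] assms(3) pq by simp
  next
    case 4
    then show ?thesis using D_last_less by simp
  qed
qed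

lemma D_chain_less:
  assumes "\<delta> + 1 \<le> d" "d < d'" "d' \<le> t - 2"
  shows "D (t + d) < D (t + d')"
proof (rule D_indep_less)
  show "t + d' \<in> J" "t + d \<in> J" using assms by (auto intro: chain_in_J)
  show "N (t + d) \<subset> N (t + d')" using assms by (auto simp: N_chain)
qed

lemma D_extra_antimono:
  assumes "1 \<le> i" "i < i'" "i' \<le> \<delta> + 1"
  shows "D (e i') < D (e i)"
  using assms(2,3)
proof (induction i')
  case (Suc l)
  then have "D (e (Suc l)) < D (e l)" using assms(1) by (intro D_extra_less) auto
  then show ?case using Suc by (cases "i = l") auto
qed simp

lemma D_extra_less_chain:
  assumes i: "1 \<le> i" "i \<le> \<delta> + 1" and d: "\<delta> + 1 \<le> d" "d \<le> t - 2"
  shows "D (e i) < D (t + d)"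
proof -
  have "D (e i) \<le> D (e 1)" using D_extra_antimono[of 1 i] i by (cases "i = 1") auto
  also have "D (e 1) < D (t + d)"
  proof (rule D_indep_less)
    show "t + d \<in> J" "e 1 \<in> J" using d by (auto intro: chain_in_J e_in_J)
    have "N (e 1) = {1..\<delta>}" "N (t + d) = {1..d}" using d by (simp_all add: N_extra N_chain)
    then show "N (e 1) \<subset> N (t + d)" using d by auto
  qed
  finally show ?thesis .
qed

lemma D_inj_indep:
  assumes "j \<in> J" "j' \<in> J" "j \<noteq> j'"
  shows "D j \<noteq> D j'"
  using assms(1)
proof (cases rule: J_cases)
  case j: (1 d)
  show ?thesis
    using assms(2)
  proof (cases rule: J_cases)
    case (1 d')
    then show ?thesis
      using j assms(3) D_chain_less[of d d'] D_chain_less[of d' d]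
      by (cases d d' rule: linorder_cases) auto
  next
    case (2 i)
    then show ?thesis using D_extra_less_chain[of i d] j by simp
  qed
next
  case j: (2 i)
  show ?thesis
    using assms(2)
  proof (cases rule: J_cases)
    case (1 d)
    then show ?thesis using D_extra_less_chain[of i d] j by simp
  next
    case (2 i')
    then show ?thesis
      using j assms(3) D_extra_antimono[of i i'] D_extra_antimono[of i' i]
      by (cases i i' rule: linorder_cases) auto
  qed
qed

text \<open>Each \<open>N j\<close> misses two of the last three clique vertices, one of which
  differs from \<open>p\<close>; ending the chain at index \<open>t - 2\<close> secures this for its
  sets.\<close>

lemma D_indep_below_clique:
  assumes j: "j \<in> J" and p: "p \<in> K"
  shows "D j < D p"
proof -
  have "\<exists>w \<in> K. w \<noteq> p \<and> w \<notin> N j"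
    using j
  proof (cases rule: J_cases)
    case (1 d)
    then have "N j = {1..d}" by (simp add: N_chain)
    then have "t \<notin> N j" "t - 1 \<notin> N j" using 1 t_bounds by auto
    moreover have "t \<in> K" "t - 1 \<in> K" "t \<noteq> t - 1" using t_bounds by (auto simp: K_def)
    ultimately show ?thesis by metis
  next
    case (2 i)
    have "t - 1 \<noteq> y l" "t - 2 \<noteq> y l" for l
      using y_near[of l \<delta>] by (simp_all add: t_def)
    then have "t - 2 \<notin> N j" "t - 1 \<notin> N j" using 2 t_bounds by (auto simp: N_extra)
    moreover have "t - 2 \<in> K" "t - 1 \<in> K" "t - 2 \<noteq> t - 1" using t_bounds by (auto simp: K_def)
    ultimately show ?thesis by metis
  qed
  then show ?thesis using D_indep_less_clique[OF j p] by blast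
qed

lemma F_irregular_H: "F_irregular F H"
proof (rule F_irregularI[OF F H], rule inj_onI, rule ccontr)
  fix a b assume "a \<in> pverts H" "b \<in> pverts H" and D: "D a = D b" and ne: "a \<noteq> b"
  then have "a \<in> K \<union> J" "b \<in> K \<union> J" by simp_all
  then consider "a \<in> K" "b \<in> K" | "a \<in> J" "b \<in> J" | "a \<in> J" "b \<in> K" | "a \<in> K" "b \<in> J"
    by blast
  then show False
  proof cases
    case 1
    then show ?thesis
      using D_inj_clique[of a b] D_inj_clique[of b a] D ne by (cases a b rule: linorder_cases) auto
  next
    case 2
    then show ?thesis using D_inj_indep[OF 2 ne] D by simp
  next
    case 3
    then show ?thesis using D_indep_below_clique[OF 3] D by simp
  next
    case 4
    then show ?thesis using D_indep_below_clique[OF 4(2,1)] D by simp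
  qed
qed

lemma M_le_card_H: "M \<le> card (pverts H)"
proof -
  have "M \<le> card K" using y_ge(2)[of \<delta>] L_bounds by (simp add: K_def t_def)
  also have "\<dots> \<le> card (pverts H)" using fin by (simp add: card_mono)
  finally show ?thesis .
qed

end

lemma connected_crossing_arc:
  assumes F: "pair_graph F" and conn: "Digraph_Component.connected (with_proj F)"
    and S: "S \<subseteq> pverts F" "S \<noteq> {}" "S \<noteq> pverts F"
  shows "\<exists>a\<in>S. \<exists>b\<in>pverts F - S. (a, b) \<in> parcs F"
proof (rule ccontr)
  assume no: "\<not> ?thesis"
  obtain a b where ab: "a \<in> S" "b \<in> pverts F" "b \<notin> S" using S by blast
  let ?M = "mk_symmetric (with_proj F)"
  have arcs: "parcs ?M = parcs F"
    using F by (force simp: parcs_mk_symmetric pair_graph_iff)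
  have "reachable (with_proj ?M) a b"
    using conn ab S(1) by (auto simp: connected_def strongly_connected_def)
  then have "(a, b) \<in> rtrancl_on (pverts F) (parcs F)"
    by (simp add: reachable_def arcs)
  then have "b \<in> S"
    by (induction rule: rtrancl_on_induct) (use ab no in auto)
  then show False using ab by simp
qed

text \<open>The non-neighbour \<open>b\<close> bounds the degree of \<open>a\<close>, hence the
  minimum degree, by \<open>k - 2\<close>. So the closed neighbourhood of \<open>v\<close> is
  proper, and an edge leaving it supplies \<open>x\<close> and \<open>u\<close>.\<close>

lemma ex_irregular_of_incomplete:
  assumes F: "pair_graph F" and conn: "Digraph_Component.connected (with_proj F)"
    and V: "3 \<le> card (pverts F)"
    and ab: "a \<in> pverts F" "b \<in> pverts F" "a \<noteq> b" "(a, b) \<notin> parcs F"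
  shows "\<exists>G :: nat pair_pre_digraph. pair_graph G \<and> F_irregular F G \<and> n \<le> card (pverts G)"
proof -
  let ?V = "pverts F"
  define k where "k = card ?V"
  have arc: "x \<in> ?V \<and> y \<in> ?V \<and> (y, x) \<in> parcs F \<and> x \<noteq> y" if "(x, y) \<in> parcs F" for x y
    using F that by (auto simp: pair_graph_iff)
  have finV: "finite ?V" using F by (simp add: pair_graph_iff)
  have nbs: "nbs F x \<subseteq> ?V - {x}" for x using arc by (auto simp: nbs_def)
  have fin_nbs: "finite (nbs F x)" for x using nbs finV by (meson finite_Diff finite_subset)
  obtain v where v: "v \<in> ?V" "\<And>w. w \<in> ?V \<Longrightarrow> card (nbs F v) \<le> card (nbs F w)"
    using ex_has_least_nat[of "\<lambda>w. w \<in> ?V" a "\<lambda>w. card (nbs F w)"] ab(1) by blast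
  have "nbs F a \<subseteq> ?V - {a, b}" using nbs[of a] ab by (auto simp: nbs_def)
  then have "card (nbs F a) \<le> k - 2"
    using card_mono[of "?V - {a, b}" "nbs F a"] finV ab by (simp add: k_def card_Diff_subset)
  then have "card (insert v (nbs F v)) < k"
    using v(2)[OF ab(1)] V fin_nbs[of v] by (auto simp: k_def card_insert_if)
  then have "insert v (nbs F v) \<noteq> ?V" by (auto simp: k_def)
  then obtain x u where xu: "x \<in> insert v (nbs F v)" "u \<in> ?V" "u \<notin> insert v (nbs F v)"
    "(x, u) \<in> parcs F"
    using connected_crossing_arc[OF F conn, of "insert v (nbs F v)"] v(1) nbs[of v] by auto
  have x: "x \<in> nbs F v" using xu by (auto simp: nbs_def)
  \<comment> \<open>An edge leaving \<open>{v, x}\<close> gives one of these two vertices a second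
    neighbour.\<close>
  have "{v, x} \<noteq> ?V" using xu by auto
  then obtain x\<^sub>0 z where z: "x\<^sub>0 \<in> {v, x}" "z \<in> ?V" "z \<notin> {v, x}" "(x\<^sub>0, z) \<in> parcs F"
    using connected_crossing_arc[OF F conn, of "{v, x}"] v(1) x nbs[of v] by auto
  have vx: "(v, x) \<in> parcs F" "(x, v) \<in> parcs F" using x arc[of v x] by (auto simp: nbs_def)
  have "\<exists>z'. z' \<noteq> z \<and> z' \<in> nbs F x\<^sub>0"
    by (rule exI[of _ "if x\<^sub>0 = v then x else v"]) (use z vx in \<open>auto simp: nbs_def\<close>)
  then obtain z' where z': "z' \<noteq> z" "{z, z'} \<subseteq> nbs F x\<^sub>0" using z by (auto simp: nbs_def)
  have deg: "2 \<le> card (nbs F x\<^sub>0)"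
    using card_mono[OF fin_nbs z'(2)] z'(1) by simp
  have "card ?V = card {1..k}" by (simp add: k_def)
  then obtain \<iota> where \<iota>: "bij_betw \<iota> ?V {1..k}"
    using finite_same_card_bij[OF finV finite_atLeastAtMost] by blast
  define M where "M = k ^ (k + 1) * (8 * k) ^ k + n + 1"
  interpret sparse_construction F v x u x\<^sub>0 z \<iota> "card (nbs F v)" k M
  proof (rule sparse_construction.intro)
    show "u \<in> nbs F x" "u \<noteq> v" "u \<notin> nbs F v" using xu by (simp_all add: nbs_def)
    show "z \<in> nbs F x\<^sub>0" using z' by simp
    show "k ^ (k + 1) * (8 * k) ^ k < M" by (simp add: M_def)
  qed (fact F v x deg \<iota> refl k_def[symmetric])+
  have "n \<le> card (pverts H)" using M_le_card_H by (simp add: M_def)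
  then show ?thesis using H F_irregular_H by blast
qed

section \<open>The main theorem\<close>

theorem mainTheorem1:
  fixes F :: "'a pair_pre_digraph"
  assumes "pair_graph F"
    and "Digraph_Component.connected (with_proj F)"
    and "card (pverts F) \<ge> 3"
  shows "\<exists>\<G> :: nat pair_pre_digraph set.
    infinite \<G> \<and>
    (\<forall>G\<in>\<G>. pair_graph G \<and> F_irregular F G) \<and>
    pairwise (\<lambda>G H. \<not> digraph_iso (with_proj G) (with_proj H)) \<G>"
proof (rule infinite_family_of_unbounded_order)
  fix n
  show "\<exists>G :: nat pair_pre_digraph. pair_graph G \<and> F_irregular F G \<and> n \<le> card (pverts G)"
  proof (cases "\<forall>a\<in>pverts F. \<forall>b\<in>pverts F. a \<noteq> b \<longrightarrow> (a, b) \<in> parcs F")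
    case True
    then show ?thesis using ex_irregular_of_complete[OF assms(1,3)] by blast
  next
    case False
    then show ?thesis using ex_irregular_of_incomplete[OF assms] by blast
  qed
qed

end
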